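(* Let $d\ge1$ and let $\{T_i\}_{i\in\mathbb Z^d}$ be the group generated by completely commuting transformations $\{T_{e_q}\}_{q=1,\dots,d}$ (with respect to $\mathcal M$ and $\mathbb P$) on a probability space $(\Omega,\mathcal F,\mathbb P)$, with associated commuting filtration $\mathcal F_i=T_i^{-1}\mathcal M$, $i\in\mathbb Z^d$. Let $f\in L^2(\mathcal F)$ be such that, for some $M\in\mathbb N$, $$\mathbb E(f\mid\mathcal F^{(q)}_{-M})=0\quad\text{and}\quad f-\mathbb E(f\mid\mathcal F^{(q)}_{M})=0\qquad\text{for all }q=1,\dots,d .$$ Then one can write $$f=\sum_{S\subset\{1,\dots,d\}}\ \prod_{q\in S^c}(I-U_{e_q})\,h_S$$ for some functions $\{h_S\}_{S\subset\{1,\dots,d\}}$ in $L^2(\mathcal F)$ (with the convention $\prod_{q\in\emptyset}(I-U_{e_q})\equiv I$) satisfying, for each $S\subset\{1,\dots,d\}$, $$h_S\in\bigcap_{q\in S}\left(L^2(\mathcal F^{(q)}_0)\ominus L^2(\mathcal F^{(q)}_{-1})\right),$$ and $$h_{\{1,\dots,d\}}=\sum_{j\in\mathbb Z^d}P_{\mathbf 0}U_jf .$$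
   Context: $S^c=\{1,\dots,d\}\setminus S$; $e_1,\dots,e_d$ are the canonical unit vectors; $I$ is the identity operator; $\mathbf 0=(0,\dots,0)$; order relations and $\wedge$ on $\mathbb Z^d$ are coordinatewise; $L^2(\mathcal G)=L^2(\Omega,\mathcal G,\mathbb P)$; $\ominus$ denotes orthogonal complement in $L^2$; for $S=\emptyset$ the intersection is $L^2(\mathcal F)$. Completely commuting transformations: $T_{e_1},\dots,T_{e_d}$ are bijective, bi-measurable, measure-preserving transformations of $(\Omega,\mathcal F,\mathbb P)$ with $T_{e_q}\circ T_{e_{q'}}=T_{e_{q'}}\circ T_{e_q}$ for all $q,q'$, generating the $\mathbb Z^d$-group $T_i=T_{e_1}^{i_1}\circ\cdots\circ T_{e_d}^{i_d}$, $i\in\mathbb Z^d$; $\mathcal M\subset\mathcal F$ is a $\sigma$-algebra with $\mathcal M\subset T_{e_q}^{-1}\mathcal M$ for $q=1,\dots,d$; and the filtration $\mathcal F_i=T_i^{-1}\mathcal M$, $i\in\mathbb Z^d$, is commuting, i.e. for all $k,\ell\in\mathbb Z^d$ and every bounded $\mathcal F_\ell$-measurable $Y$, $\mathbb E(Y\mid\mathcal F_k)=\mathbb E(Y\mid\mathcal F_{k\wedge\ell})$ almost surely. For $q=1,\dots,d$ and $\ell\in\mathbb Z$: $\mathcal F^{(q)}_\ell=\bigvee_{i\in\mathbb Z^d,\,i_q\le\ell}\mathcal F_i$ and $P^{(q)}_\ell g=\mathbb E(g\mid\mathcal F^{(q)}_\ell)-\mathbb E(g\mid\mathcal F^{(q)}_{\ell-1})$.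 For $j\in\mathbb Z^d$, $P_j=\prod_{q=1}^dP^{(q)}_{j_q}$ (composition of operators, which commute). $U_ig=g\circ T_i$ for $i\in\mathbb Z^d$. *)

theory Defs
  imports "HOL-Probability.Probability"
begin

text \<open>
  Coordinates are indexed by \<open>{1..d}\<close>. A \<open>\<sigma>\<close>-algebra is represented by a measure object of which
  only the space and the measurable sets matter; \<open>real_cond_exp P G\<close> is conditional expectation
  under \<open>P\<close> given \<open>G\<close>, one fixed version, so identities between functions are stated
  \<open>P\<close>-almost everywhere.
\<close>

definition Zd :: "nat \<Rightarrow> (nat \<Rightarrow> int) set" where
  "Zd d = {i. \<forall>q. q \<notin> {1..d} \<longrightarrow> i q = 0}"

definition unit_vec :: "nat \<Rightarrow> nat \<Rightarrow> int" where
  "unit_vec q = (\<lambda>r. if r = q then 1 else 0)"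

text \<open>Composition of the maps \<open>A q\<close>, \<open>q \<in> S\<close> (finite), from left to right in increasing order
  of \<open>q\<close>; the identity for empty \<open>S\<close>.\<close>

definition comp_over :: "nat set \<Rightarrow> (nat \<Rightarrow> 'b \<Rightarrow> 'b) \<Rightarrow> 'b \<Rightarrow> 'b" where
  "comp_over S A = foldr (\<circ>) (map A (sorted_list_of_set S)) id"

text \<open>Integer powers of a bijection of \<open>X\<close>; the values are meaningful on \<open>X\<close> only.\<close>

definition int_funpow :: "'a set \<Rightarrow> ('a \<Rightarrow> 'a) \<Rightarrow> int \<Rightarrow> 'a \<Rightarrow> 'a" where
  "int_funpow X t n = (if n \<ge> 0 then t ^^ nat n else inv_into X t ^^ nat (- n))"

definition action :: "'a measure \<Rightarrow> nat \<Rightarrow> (nat \<Rightarrow> 'a \<Rightarrow> 'a) \<Rightarrow> (nat \<Rightarrow> int) \<Rightarrow> 'a \<Rightarrow> 'a" where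
  "action P d T i = comp_over {1..d} (\<lambda>q. int_funpow (space P) (T q) (i q))"

definition koopman ::
  "'a measure \<Rightarrow> nat \<Rightarrow> (nat \<Rightarrow> 'a \<Rightarrow> 'a) \<Rightarrow> (nat \<Rightarrow> int) \<Rightarrow> ('a \<Rightarrow> real) \<Rightarrow> 'a \<Rightarrow> real" where
  "koopman P d T i g = g \<circ> action P d T i"

definition filt ::
  "'a measure \<Rightarrow> nat \<Rightarrow> (nat \<Rightarrow> 'a \<Rightarrow> 'a) \<Rightarrow> 'a measure \<Rightarrow> (nat \<Rightarrow> int) \<Rightarrow> 'a measure" where
  "filt P d T \<M> i = vimage_algebra (space P) (action P d T i) \<M>"

definition commuting_filtration ::
  "'a measure \<Rightarrow> nat \<Rightarrow> ((nat \<Rightarrow> int) \<Rightarrow> 'a measure) \<Rightarrow> bool" where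
  "commuting_filtration P d F \<longleftrightarrow>
     (\<forall>k\<in>Zd d. \<forall>l\<in>Zd d. \<forall>Y :: 'a \<Rightarrow> real.
        Y \<in> borel_measurable (F l) \<and> bounded (Y ` space P) \<longrightarrow>
        (AE x in P. real_cond_exp P (F k) Y x = real_cond_exp P (F (inf k l)) Y x))"

locale completely_commuting = prob_space P
  for P :: "'a measure" and d :: nat and T :: "nat \<Rightarrow> 'a \<Rightarrow> 'a" and \<M> :: "'a measure" +
  assumes bij: "\<And>q. q \<in> {1..d} \<Longrightarrow> bij_betw (T q) (space P) (space P)"
    and meas: "\<And>q. q \<in> {1..d} \<Longrightarrow> T q \<in> P \<rightarrow>\<^sub>M P"
    and meas_inv: "\<And>q. q \<in> {1..d} \<Longrightarrow> inv_into (space P) (T q) \<in> P \<rightarrow>\<^sub>M P"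
    and preserving: "\<And>q. q \<in> {1..d} \<Longrightarrow> distr P P (T q) = P"
    and commute: "\<And>q r x. q \<in> {1..d} \<Longrightarrow> r \<in> {1..d} \<Longrightarrow> x \<in> space P \<Longrightarrow> T q (T r x) = T r (T q x)"
    and subalg: "subalgebra P \<M>"
    and increasing: "\<And>q. q \<in> {1..d} \<Longrightarrow> sets \<M> \<subseteq> sets (vimage_algebra (space P) (T q) \<M>)"
    and commuting: "commuting_filtration P d (filt P d T \<M>)"

definition dir_filt ::
  "'a measure \<Rightarrow> nat \<Rightarrow> (nat \<Rightarrow> 'a \<Rightarrow> 'a) \<Rightarrow> 'a measure \<Rightarrow> nat \<Rightarrow> int \<Rightarrow> 'a measure" where
  "dir_filt P d T \<M> q l =
     sigma (space P) (\<Union>i\<in>{i \<in> Zd d. i q \<le> l}. sets (filt P d T \<M> i))"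

definition dir_proj ::
  "'a measure \<Rightarrow> nat \<Rightarrow> (nat \<Rightarrow> 'a \<Rightarrow> 'a) \<Rightarrow> 'a measure \<Rightarrow> nat \<Rightarrow> int \<Rightarrow> ('a \<Rightarrow> real) \<Rightarrow> 'a \<Rightarrow> real" where
  "dir_proj P d T \<M> q l g =
     (\<lambda>x. real_cond_exp P (dir_filt P d T \<M> q l) g x
        - real_cond_exp P (dir_filt P d T \<M> q (l - 1)) g x)"

definition proj ::
  "'a measure \<Rightarrow> nat \<Rightarrow> (nat \<Rightarrow> 'a \<Rightarrow> 'a) \<Rightarrow> 'a measure \<Rightarrow> (nat \<Rightarrow> int) \<Rightarrow> ('a \<Rightarrow> real) \<Rightarrow> 'a \<Rightarrow> real" where
  "proj P d T \<M> j = comp_over {1..d} (\<lambda>q. dir_proj P d T \<M> q (j q))"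

text \<open>\<open>L2 P G\<close> consists of all representatives of the elements of \<open>L\<^sup>2(G)\<close>, viewed as a subspace of
  \<open>L\<^sup>2(P)\<close>: membership is invariant under replacing a function by a \<open>P\<close>-measurable one equal to it almost everywhere. With strict
  \<open>G\<close>-measurability instead, the intersection of several such spaces could be too small.\<close>

definition L2 :: "'a measure \<Rightarrow> 'a measure \<Rightarrow> ('a \<Rightarrow> real) set" where
  "L2 P G = {h \<in> borel_measurable P. integrable P (\<lambda>x. (h x)\<^sup>2) \<and>
               (\<exists>g\<in>borel_measurable G. AE x in P. h x = g x)}"

definition L2_ominus ::
  "'a measure \<Rightarrow> ('a \<Rightarrow> real) set \<Rightarrow> ('a \<Rightarrow> real) set \<Rightarrow> ('a \<Rightarrow> real) set" where
  "L2_ominus P A B = {h \<in> A. \<forall>g\<in>B. (LINT x|P. h x * g x) = 0}"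

text \<open>Unconditional convergence of \<open>\<Sum>j\<in>J. g j\<close> to \<open>s\<close> in \<open>L\<^sup>2(P)\<close>.\<close>

definition L2_has_sum ::
  "'a measure \<Rightarrow> ('i \<Rightarrow> 'a \<Rightarrow> real) \<Rightarrow> 'i set \<Rightarrow> ('a \<Rightarrow> real) \<Rightarrow> bool" where
  "L2_has_sum P g J s \<longleftrightarrow> (\<forall>j\<in>J. g j \<in> L2 P P) \<and> s \<in> L2 P P \<and>
     ((\<lambda>A. sqrt (LINT x|P. (s x - (\<Sum>j\<in>A. g j x))\<^sup>2)) \<longlongrightarrow> 0) (finite_subsets_at_top J)"

end

theory Submission
  imports Defs
begin

text \<open>
  In one direction \<open>q\<close> write \<open>U\<close> for \<open>U\<^sub>e\<close> with \<open>e = e\<^sub>q\<close> and \<open>P\<^sub>l\<close> for \<open>P\<^sup>(\<^sup>q\<^sup>)\<^sub>l\<close>. The hypotheses on \<open>f\<close> make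
  \<open>f\<close> the sum of \<open>P\<^sub>-\<^sub>l f\<close> over \<open>-M \<le> l < M\<close>, and \<open>P\<^sub>-\<^sub>l f = U\<^sup>-\<^sup>l P\<^sub>0 U\<^sup>l f\<close> differs from \<open>P\<^sub>0 U\<^sup>l f\<close> by
  \<open>(I - U)\<close> applied to a finite geometric sum. Hence \<open>f = A\<^sub>q f + (I - U) B\<^sub>q f\<close> with \<open>A\<^sub>q\<close> the sum of
  \<open>P\<^sub>0 U\<^sup>l\<close>. Conditional expectations along different directions commute, hence so do all the operators
  attached to different directions, and expanding the product of \<open>A\<^sub>q + (I - U) B\<^sub>q\<close> over \<open>q\<close> gives the
  claim, \<open>h\<^sub>S\<close> being the product of the \<open>A\<^sub>q\<close>, \<open>q \<in> S\<close>, and the \<open>B\<^sub>q\<close>, \<open>q \<notin> S\<close>, applied to \<open>f\<close>.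
\<close>

section \<open>Composition and the group action\<close>

lemma sorted_list_of_set_insert_max:
  assumes "finite S" "\<And>s. s \<in> S \<Longrightarrow> s < (m :: 'b :: linorder)"
  shows "sorted_list_of_set (insert m S) = sorted_list_of_set S @ [m]"
proof -
  have "sorted_wrt (<) (sorted_list_of_set S @ [m])"
    using assms by (simp add: sorted_wrt_append)
  moreover have "set (sorted_list_of_set S @ [m]) = insert m S"
    using assms by simp
  ultimately show ?thesis
    by (metis sorted_list_of_set.idem_if_sorted_distinct strict_sorted_iff)
qed

lemma comp_over_empty [simp]: "comp_over {} A = id"
  by (simp add: comp_over_def)

lemma comp_over_insert_max:
  assumes "finite S" "\<And>s. s \<in> S \<Longrightarrow> s < m"
  shows "comp_over (insert m S) A = comp_over S A \<circ> A m"
proof -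
  have "foldr (\<circ>) (xs @ [a]) id = foldr (\<circ>) xs id \<circ> a" for xs and a :: "'b \<Rightarrow> 'b"
    by (induction xs) (simp_all add: comp_assoc)
  then show ?thesis
    by (simp add: comp_over_def sorted_list_of_set_insert_max[OF assms])
qed

text \<open>The recursion behind every induction on the number of directions: the factor of largest
  index acts first, so the remaining product sees a modified argument. The inductions therefore
  generalise over the argument.\<close>

lemma comp_over_Suc: "comp_over {1..Suc n} A = comp_over {1..n} A \<circ> A (Suc n)"
  using comp_over_insert_max[of "{1..n}" "Suc n" A] by (simp add: atLeastAtMostSuc_conv)

lemma comp_over_induct:
  assumes "finite S" "Q id" "\<And>q h. q \<in> S \<Longrightarrow> Q h \<Longrightarrow> Q (A q \<circ> h)"
  shows "Q (comp_over S A)"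
proof -
  have "Q (foldr (\<circ>) (map A xs) id)" if "set xs \<subseteq> S" for xs
    using that by (induction xs) (auto simp: assms(2,3))
  then show ?thesis
    using assms(1) by (simp add: comp_over_def)
qed

lemma comp_over_cong:
  assumes "finite S" "\<And>q. q \<in> S \<Longrightarrow> A q = B q"
  shows "comp_over S A = comp_over S B"
  using assms by (auto simp: comp_over_def intro!: arg_cong[where f = "\<lambda>xs. foldr (\<circ>) xs id"])

text \<open>Each factor of \<open>F\<close> travels inwards through the \<open>G r\<close> of
  smaller index until it meets its partner. Closure and commutation are asked for on
  \<open>X\<close> only, because powers of an inverse are meaningful only there.\<close>

lemma comp_over_comp:
  assumes "\<And>q x. q \<in> {1..n} \<Longrightarrow> x \<in> X \<Longrightarrow> F q x \<in> X"
    and "\<And>q x. q \<in> {1..n} \<Longrightarrow> x \<in> X \<Longrightarrow> G q x \<in> X"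
    and "\<And>q r x. q \<in> {1..n} \<Longrightarrow> r \<in> {1..n} \<Longrightarrow> x \<in> X \<Longrightarrow> F q (G r x) = G r (F q x)"
    and "x \<in> X"
  shows "comp_over {1..n} F (comp_over {1..n} G x) = comp_over {1..n} (\<lambda>q x. F q (G q x)) x"
  using assms
proof (induction n arbitrary: x)
  case 0
  then show ?case by simp
next
  case (Suc n)
  have in_X: "comp_over {1..n} G y \<in> X" if "y \<in> X" for y
    using comp_over_induct[of "{1..n}" "\<lambda>h. \<forall>y\<in>X. h y \<in> X" G] Suc.prems(2) that by auto
  have com: "\<forall>y\<in>X. comp_over {1..n} G y \<in> X \<and>
      F (Suc n) (comp_over {1..n} G y) = comp_over {1..n} G (F (Suc n) y)"
    by (rule comp_over_induct) (use Suc.prems(1-3) in auto)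
  have IH: "comp_over {1..n} F (comp_over {1..n} G y) = comp_over {1..n} (\<lambda>q x. F q (G q x)) y"
    if "y \<in> X" for y
    by (rule Suc.IH) (use Suc.prems that in auto)
  have "comp_over {1..Suc n} F (comp_over {1..Suc n} G x)
      = comp_over {1..n} F (comp_over {1..n} G (F (Suc n) (G (Suc n) x)))"
    unfolding comp_over_Suc comp_apply using com Suc.prems(2,4) by simp
  also have "\<dots> = comp_over {1..Suc n} (\<lambda>q x. F q (G q x)) x"
    unfolding comp_over_Suc comp_apply using Suc.prems(1,2,4) by (intro IH) simp
  finally show ?case .
qed

section \<open>Integer powers of a bijection\<close>

context
  fixes X :: "'a set" and t :: "'a \<Rightarrow> 'a"
  assumes bij: "bij_betw t X X"
begin

lemma int_funpow_0 [simp]: "int_funpow X t 0 = id"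
  by (simp add: int_funpow_def id_def)

lemma inv_into_funpow_mem: "x \<in> X \<Longrightarrow> (inv_into X t ^^ n) x \<in> X"
  by (induction n) (use bij in \<open>auto simp: bij_betw_def intro: inv_into_into\<close>)

lemma int_funpow_mem: "x \<in> X \<Longrightarrow> int_funpow X t n x \<in> X"
proof -
  assume x: "x \<in> X"
  then have "(t ^^ k) x \<in> X" for k
    by (induction k) (use bij in \<open>auto simp: bij_betw_def\<close>)
  then show ?thesis using inv_into_funpow_mem[OF x] by (simp add: int_funpow_def)
qed

lemma int_funpow_plus_one:
  assumes x: "x \<in> X"
  shows "int_funpow X t (n + 1) x = t (int_funpow X t n x)"
proof (cases "n \<ge> 0")
  case True
  then show ?thesis by (simp add: int_funpow_def nat_add_distrib)
next
  case False
  then obtain k where k: "nat (- n) = Suc k"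
    by (metis not_le gr0_implies_Suc neg_0_less_iff_less zero_less_nat_eq)
  then have n: "n = - int (Suc k)" by simp
  have "t (inv_into X t ((inv_into X t ^^ k) x)) = (inv_into X t ^^ k) x"
    using bij inv_into_funpow_mem[OF x, of k] by (simp add: bij_betw_def f_inv_into_f)
  then show ?thesis
    unfolding n by (cases "k = 0") (simp_all add: int_funpow_def nat_add_distrib)
qed

lemma int_funpow_add:
  assumes x: "x \<in> X"
  shows "int_funpow X t (m + n) x = int_funpow X t m (int_funpow X t n x)"
proof (induction m rule: int_induct[where k = 0])
  case base
  then show ?case by simp
next
  case (step1 i)
  then show ?case
    using int_funpow_plus_one[OF x, of "i + n"] int_funpow_plus_one[OF int_funpow_mem[OF x], of i n]
    by (simp add: algebra_simps)
next
  case (step2 i)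
  \<comment> \<open>Going down by one: both sides agree after one application of \<open>t\<close>,
    and injectivity of \<open>t\<close> on \<open>X\<close> removes it.\<close>
  have "t (int_funpow X t (i - 1 + n) x) = t (int_funpow X t (i - 1) (int_funpow X t n x))"
    using int_funpow_plus_one[OF x, of "i - 1 + n"]
      int_funpow_plus_one[OF int_funpow_mem[OF x], of "i - 1" n] step2
    by (simp add: algebra_simps)
  then show ?case
    using bij int_funpow_mem[OF x] int_funpow_mem[OF int_funpow_mem[OF x]]
    by (auto simp: bij_betw_def dest: inj_onD)
qed

lemma int_funpow_commute:
  assumes s: "\<And>x. x \<in> X \<Longrightarrow> s x \<in> X" "\<And>x. x \<in> X \<Longrightarrow> s (t x) = t (s x)" and x: "x \<in> X"
  shows "s (int_funpow X t n x) = int_funpow X t n (s x)"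
proof (induction n rule: int_induct[where k = 0])
  case base
  then show ?case by simp
next
  case (step1 i)
  then show ?case
    by (simp add: int_funpow_plus_one x s int_funpow_mem)
next
  case (step2 i)
  have "t (s (int_funpow X t (i - 1) x)) = t (int_funpow X t (i - 1) (s x))"
    using int_funpow_plus_one[OF x, of "i - 1"] int_funpow_plus_one[OF s(1)[OF x], of "i - 1"] step2
      s(2)[OF int_funpow_mem[OF x]]
    by simp
  then show ?case
    using bij int_funpow_mem[OF x] int_funpow_mem[OF s(1)[OF x]] s(1)
    by (auto simp: bij_betw_def dest: inj_onD)
qed

end

section \<open>Measure-preserving maps\<close>

definition measure_preserving_map :: "'a measure \<Rightarrow> ('a \<Rightarrow> 'a) \<Rightarrow> bool" where
  "measure_preserving_map P t \<longleftrightarrow> t \<in> P \<rightarrow>\<^sub>M P \<and> distr P P t = P"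

lemma measure_preserving_map_id: "measure_preserving_map P id"
  by (simp add: measure_preserving_map_def id_def)

lemma measure_preserving_map_comp:
  assumes "measure_preserving_map P s" "measure_preserving_map P t"
  shows "measure_preserving_map P (s \<circ> t)"
proof -
  have "distr P P (s \<circ> t) = distr (distr P P t) P s"
    using assms by (intro distr_distr[symmetric]) (auto simp: measure_preserving_map_def)
  then show ?thesis
    using assms by (auto simp: measure_preserving_map_def)
qed

lemma measure_preserving_map_funpow:
  "measure_preserving_map P t \<Longrightarrow> measure_preserving_map P (t ^^ n)"
  by (induction n) (simp_all add: measure_preserving_map_id measure_preserving_map_comp)

text \<open>Since \<open>P\<close> is its own image under \<open>t\<close>, its image under the
  inverse is its image under the inverse after \<open>t\<close>, that is, under the identity of the
  space.\<close>

lemma measure_preserving_map_inv_into: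
  assumes t: "measure_preserving_map P t" "bij_betw t (space P) (space P)"
    and inv: "inv_into (space P) t \<in> P \<rightarrow>\<^sub>M P"
  shows "measure_preserving_map P (inv_into (space P) t)"
proof -
  have "distr P P (inv_into (space P) t) = distr (distr P P t) P (inv_into (space P) t)"
    using t by (simp add: measure_preserving_map_def)
  also have "\<dots> = distr P P (inv_into (space P) t \<circ> t)"
    using t inv by (intro distr_distr) (auto simp: measure_preserving_map_def)
  also have "\<dots> = distr P P (\<lambda>x. x)"
    using t(2) by (intro distr_cong) (auto simp: bij_betw_def)
  finally show ?thesis
    using inv by (simp add: measure_preserving_map_def)
qed

lemma measure_preserving_map_int_funpow:
  assumes "measure_preserving_map P t" "bij_betw t (space P) (space P)"
    and "inv_into (space P) t \<in> P \<rightarrow>\<^sub>M P"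
  shows "measure_preserving_map P (int_funpow (space P) t n)"
  using assms
  by (auto simp: int_funpow_def intro!: measure_preserving_map_funpow measure_preserving_map_inv_into)

section \<open>The group generated by the transformations\<close>

context completely_commuting
begin

abbreviation act :: "(nat \<Rightarrow> int) \<Rightarrow> 'a \<Rightarrow> 'a" where
  "act \<equiv> action P d T"

lemma T_mem: "q \<in> {1..d} \<Longrightarrow> x \<in> space P \<Longrightarrow> T q x \<in> space P"
  using bij by (auto simp: bij_betw_def)

lemma act_measure_preserving: "measure_preserving_map P (act i)"
  unfolding action_def
proof (rule comp_over_induct)
  fix q and h :: "'a \<Rightarrow> 'a" assume q: "q \<in> {1..d}" "measure_preserving_map P h"
  then have "measure_preserving_map P (T q)"
    using meas preserving by (auto simp: measure_preserving_map_def)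
  then show "measure_preserving_map P (int_funpow (space P) (T q) (i q) \<circ> h)"
    by (intro measure_preserving_map_comp measure_preserving_map_int_funpow q(2) bij[OF q(1)]
        meas_inv[OF q(1)])
qed (rule finite_atLeastAtMost measure_preserving_map_id)+

lemma act_measurable [measurable]: "act i \<in> P \<rightarrow>\<^sub>M P"
  using act_measure_preserving by (auto simp: measure_preserving_map_def)

lemma distr_act: "distr P P (act i) = P"
  using act_measure_preserving by (auto simp: measure_preserving_map_def)

lemma act_mem: "x \<in> space P \<Longrightarrow> act i x \<in> space P"
  using measurable_space[OF act_measurable] .

text \<open>Powers in all directions commute, so the two products merge direction by direction
  (\<open>comp_over_comp\<close>), and within one direction the exponents add.\<close>

lemma act_add:
  assumes x: "x \<in> space P"
  shows "act i (act j x) = act (\<lambda>q. i q + j q) x"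
proof -
  let ?p = "\<lambda>q. int_funpow (space P) (T q)"
  have com: "?p q m (?p r n y) = ?p r n (?p q m y)"
    if "q \<in> {1..d}" "r \<in> {1..d}" "y \<in> space P" for q r m n y
  proof -
    have "T q (?p r n z) = ?p r n (T q z)" if "z \<in> space P" for z
      using \<open>q \<in> {1..d}\<close> \<open>r \<in> {1..d}\<close> that
      by (intro int_funpow_commute[OF bij]) (auto intro: T_mem commute)
    then show ?thesis
      using that by (intro int_funpow_commute[OF bij[OF that(1)], symmetric])
        (auto intro: int_funpow_mem[OF bij])
  qed
  have "act i (act j x) = comp_over {1..d} (\<lambda>q x. ?p q (i q) (?p q (j q) x)) x"
    unfolding action_def using com x by (intro comp_over_comp) (auto intro: int_funpow_mem[OF bij])
  also have "\<dots> = comp_over {1..d} (\<lambda>q. ?p q (i q + j q)) x"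
  proof -
    have "\<forall>x\<in>space P. comp_over {1..n} (\<lambda>q x. ?p q (i q) (?p q (j q) x)) x
        = comp_over {1..n} (\<lambda>q. ?p q (i q + j q)) x" if "n \<le> d" for n
      using that
    proof (induction n)
      case (Suc n)
      then have "bij_betw (T (Suc n)) (space P) (space P)"
        by (intro bij) auto
      with Suc show ?case
        unfolding comp_over_Suc comp_apply by (simp add: int_funpow_add int_funpow_mem)
    qed simp
    then show ?thesis using x by simp
  qed
  finally show ?thesis by (simp add: action_def)
qed

lemma act_eq_id:
  assumes "\<And>q. q \<in> {1..d} \<Longrightarrow> i q = 0"
  shows "act i = id"
proof -
  have "act i = comp_over {1..d} (\<lambda>q. id :: 'a \<Rightarrow> 'a)"
    unfolding action_def using assms by (intro comp_over_cong) (auto simp: int_funpow_def)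
  also have "\<dots> = id"
    by (rule comp_over_induct) auto
  finally show ?thesis .
qed

end

section \<open>Square integrability and conditional expectations\<close>

lemma L2_self_iff: "g \<in> L2 M M \<longleftrightarrow> g \<in> borel_measurable M \<and> integrable M (\<lambda>x. (g x)\<^sup>2)"
  by (auto simp: L2_def)

lemma L2_self_measurable: "g \<in> L2 M M \<Longrightarrow> g \<in> borel_measurable M"
  by (simp add: L2_self_iff)

lemma L2_mult_integrable:
  assumes "f \<in> L2 M M" "g \<in> L2 M M"
  shows "integrable M (\<lambda>x. f x * g x)"
proof (rule Bochner_Integration.integrable_bound)
  show "integrable M (\<lambda>x. (f x)\<^sup>2 + (g x)\<^sup>2)"
    using assms by (simp add: L2_self_iff)
  show "AE x in M. norm (f x * g x) \<le> norm ((f x)\<^sup>2 + (g x)\<^sup>2)"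
  proof (rule AE_I2)
    fix x
    have "2 * (\<bar>f x\<bar> * \<bar>g x\<bar>) \<le> (f x)\<^sup>2 + (g x)\<^sup>2"
      using sum_squares_bound[of "\<bar>f x\<bar>" "\<bar>g x\<bar>"] by simp
    moreover have "0 \<le> \<bar>f x\<bar> * \<bar>g x\<bar>" by simp
    ultimately have "\<bar>f x\<bar> * \<bar>g x\<bar> \<le> (f x)\<^sup>2 + (g x)\<^sup>2" by linarith
    then show "norm (f x * g x) \<le> norm ((f x)\<^sup>2 + (g x)\<^sup>2)"
      by (simp add: abs_mult)
  qed
qed (use assms in \<open>auto simp: L2_self_iff\<close>)

lemma L2_add:
  assumes "f \<in> L2 M M" "g \<in> L2 M M"
  shows "(\<lambda>x. f x + g x) \<in> L2 M M"
  using assms L2_mult_integrable[OF assms]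
  by (auto simp: L2_self_iff power2_sum mult.assoc)

lemma L2_diff:
  assumes "f \<in> L2 M M" "g \<in> L2 M M"
  shows "(\<lambda>x. f x - g x) \<in> L2 M M"
  using assms L2_mult_integrable[OF assms]
  by (auto simp: L2_self_iff power2_diff mult.assoc)

lemma L2_zero: "(\<lambda>x. 0) \<in> L2 M M"
  by (simp add: L2_self_iff)

lemma L2_sum:
  assumes "\<And>i. i \<in> I \<Longrightarrow> g i \<in> L2 M M"
  shows "(\<lambda>x. \<Sum>i\<in>I. g i x) \<in> L2 M M"
  using assms by (induction I rule: infinite_finite_induct) (auto intro: L2_add L2_zero)

lemma L2_cong_AE:
  assumes "f \<in> L2 M M" "g \<in> borel_measurable M" "AE x in M. f x = g x"
  shows "g \<in> L2 M M"
proof -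
  have "integrable M (\<lambda>x. (g x)\<^sup>2) \<longleftrightarrow> integrable M (\<lambda>x. (f x)\<^sup>2)"
    using assms by (intro integrable_cong_AE) (auto simp: L2_self_iff)
  then show ?thesis using assms by (simp add: L2_self_iff)
qed

context finite_measure
begin

lemma L2_integrable: "g \<in> L2 M M \<Longrightarrow> integrable M g"
  by (simp add: L2_self_iff square_integrable_imp_integrable)

lemma L2_indicator: "A \<in> sets M \<Longrightarrow> indicator A \<in> L2 M M"
  by (simp add: L2_self_iff power2_eq_square indicator_inter_arith[symmetric] integrable_indicator_iff less_top[symmetric])

end

text \<open>Conditional Jensen inequality for the square.\<close>

lemma (in finite_measure_subalgebra) real_cond_exp_L2:
  assumes "g \<in> L2 M M"
  shows "real_cond_exp M F g \<in> L2 M M"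
proof -
  have "integrable M (\<lambda>x. (real_cond_exp M F g x)\<^sup>2)"
    using assms L2_integrable[OF assms]
    by (intro integrable_convex_cond_exp[where I = UNIV]) (auto simp: L2_self_iff convex_power2)
  then show ?thesis by (simp add: L2_self_iff)
qed

text \<open>Both sides equal the integral of the product of the two conditional
  expectations.\<close>

lemma (in finite_measure_subalgebra) real_cond_exp_self_adjoint:
  assumes f: "f \<in> L2 M M" and g: "g \<in> L2 M M"
  shows "(LINT x|M. f x * real_cond_exp M F g x) = (LINT x|M. real_cond_exp M F f x * g x)"
proof -
  have *: "(LINT x|M. real_cond_exp M F u x * real_cond_exp M F v x)
      = (LINT x|M. real_cond_exp M F u x * v x)" if "u \<in> L2 M M" "v \<in> L2 M M" for u v
    using that
    by (intro real_cond_exp_intg(2) L2_mult_integrable real_cond_exp_L2)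
      (auto simp: L2_self_iff)
  show ?thesis
    using *[OF f g] *[OF g f] by (simp add: mult.commute)
qed

text \<open>A Dynkin class argument: equality of the integrals passes to complements and to
  countable disjoint unions. Membership of the whole space in \<open>G\<close> supplies the equal
  total integrals that complements require.\<close>

lemma (in finite_measure_subalgebra) set_integral_eq_generatorI:
  fixes u v :: "'a \<Rightarrow> real"
  assumes F: "sets F = sigma_sets (space M) G" "Int_stable G" "G \<subseteq> Pow (space M)" "space M \<in> G"
    and u: "integrable M u" and v: "integrable M v"
    and eq: "\<And>A. A \<in> G \<Longrightarrow> (LINT x:A|M. u x) = (LINT x:A|M. v x)"
    and A: "A \<in> sets F"
  shows "(LINT x:A|M. u x) = (LINT x:A|M. v x)"
proof -
  have F_M: "B \<in> sets M" if "B \<in> sigma_sets (space M) G" for B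
    using that F(1) subalg by (auto simp: subalgebra_def)
  have int: "set_integrable M B w" if "B \<in> sets M" "integrable M w" for B and w :: "'a \<Rightarrow> real"
    using that unfolding set_integrable_def by (rule integrable_mult_indicator)
  from F(2,3) A[unfolded F(1)] show ?thesis
  proof (induction A rule: sigma_sets_induct_disjoint)
    case (basic A)
    then show ?case by (rule eq)
  next
    case empty
    then show ?case by (simp add: set_lebesgue_integral_def)
  next
    case (compl A)
    have A: "A \<in> sets M" using F_M compl by simp
    have "(LINT x:space M - A|M. w x) = (LINT x:space M|M. w x) - (LINT x:A|M. w x)"
      if "integrable M w" for w :: "'a \<Rightarrow> real"
    proof -
      have "(LINT x:A \<union> (space M - A)|M. w x) = (LINT x:A|M. w x) + (LINT x:space M - A|M. w x)"
        using A that by (intro set_integral_Un int) auto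
      moreover have "A \<union> (space M - A) = space M"
        using A sets.sets_into_space by auto
      ultimately show ?thesis by simp
    qed
    then show ?case using u v compl eq[OF F(4)] by simp
  next
    case (union A)
    have A: "A i \<in> sets M" for i using F_M union(2) by auto
    have "(LINT x:(\<Union>i. A i)|M. w x) = (\<Sum>i. (LINT x:A i|M. w x))"
      if "integrable M w" for w :: "'a \<Rightarrow> real"
      using A that union(1)
      by (intro lebesgue_integral_countable_add int) (auto simp: disjoint_family_on_def)
    then show ?case using u v union(3) by simp
  qed
qed

text \<open>The directional sigma-algebras are joins of infinitely many \<open>F i\<close>; this
  reduces an identity of conditional expectations given such a join to tests on sets of a single
  \<open>F i\<close>.\<close>

lemma (in finite_measure_subalgebra) real_cond_exp_eq_generatorI:
  assumes "sets F = sigma_sets (space M) G" "Int_stable G" "G \<subseteq> Pow (space M)" "space M \<in> G"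
    and u: "integrable M u" and v: "integrable M v"
    and "\<And>A. A \<in> G \<Longrightarrow> (LINT x:A|M. u x) = (LINT x:A|M. v x)"
  shows "AE x in M. real_cond_exp M F u x = real_cond_exp M F v x"
  using set_integral_eq_generatorI[OF assms] real_cond_exp_intA[OF v] u v
  by (intro real_cond_exp_charact) (auto intro: real_cond_exp_int(1))

text \<open>Change of variables: a set of the pulled-back sigma-algebra is the preimage of some
  \<open>B\<close> in \<open>G\<close>, and integrating a function composed with \<open>t\<close>
  over it amounts to integrating the function over \<open>B\<close>.\<close>

lemma real_cond_exp_comp_measure_preserving:
  assumes "prob_space P" and t: "measure_preserving_map P t"
    and G: "subalgebra P G" and g: "integrable P g"
  shows "AE x in P. real_cond_exp P (vimage_algebra (space P) t G) (\<lambda>x. g (t x)) x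
    = real_cond_exp P G g (t x)"
proof -
  interpret prob_space P by fact
  have t_meas [measurable]: "t \<in> P \<rightarrow>\<^sub>M P" and t_distr: "distr P P t = P"
    using t by (auto simp: measure_preserving_map_def)
  have sp: "space G = space P" using G by (simp add: subalgebra_def)
  have t_G: "t \<in> P \<rightarrow>\<^sub>M G"
    using G by (intro measurableI) (auto simp: subalgebra_def intro: measurable_space[OF t_meas] measurable_sets[OF t_meas])
  have t_sp: "t \<in> space P \<rightarrow> space G" using measurable_space[OF t_G] by auto
  interpret G: finite_measure_subalgebra P G by unfold_locales fact
  interpret V: finite_measure_subalgebra P "vimage_algebra (space P) t G"
    by unfold_locales (auto simp: subalgebra_def intro: sets_image_in_sets[OF refl t_G, THEN subsetD])
  have int: "integrable P (\<lambda>x. w (t x))" if "integrable P w" for w :: "'a \<Rightarrow> real"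
    using integrable_distr[OF t_meas, of w] that t_distr by simp
  show ?thesis
  proof (rule V.real_cond_exp_charact)
    fix A assume "A \<in> sets (vimage_algebra (space P) t G)"
    then obtain B where B: "B \<in> sets G" and A: "A = t -` B \<inter> space P"
      using sets_vimage_algebra2[OF t_sp] by auto
    have [measurable]: "B \<in> sets P" using B G by (auto simp: subalgebra_def)
    have *: "(LINT x:A|P. w (t x)) = (LINT x:B|P. w x)" if [measurable]: "integrable P w" for w :: "'a \<Rightarrow> real"
    proof -
      have "(LINT x:B|P. w x) = (LINT x:B|distr P P t. w x)"
        by (simp add: t_distr)
      also have "\<dots> = (LINT x|P. indicator B (t x) *\<^sub>R w (t x))"
        unfolding set_lebesgue_integral_def by (rule integral_distr) measurable
      also have "\<dots> = (LINT x:A|P. w (t x))"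
        unfolding set_lebesgue_integral_def A
        by (intro Bochner_Integration.integral_cong) (auto simp: indicator_def)
      finally show ?thesis by simp
    qed
    show "(LINT x:A|P. g (t x)) = (LINT x:A|P. real_cond_exp P G g (t x))"
      using *[OF g] *[OF G.real_cond_exp_int(1)[OF g]] G.real_cond_exp_intA[OF g B] by simp
  next
    show "(\<lambda>x. real_cond_exp P G g (t x)) \<in> borel_measurable (vimage_algebra (space P) t G)"
      by (rule measurable_compose[OF measurable_vimage_algebra1[OF t_sp]]) simp
  qed (use g G.real_cond_exp_int(1)[OF g] in \<open>auto intro: int\<close>)
qed

section \<open>The commuting filtration\<close>

context completely_commuting
begin

abbreviation F :: "(nat \<Rightarrow> int) \<Rightarrow> 'a measure" where
  "F \<equiv> filt P d T \<M>"

abbreviation DF :: "nat \<Rightarrow> int \<Rightarrow> 'a measure" where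
  "DF \<equiv> dir_filt P d T \<M>"

abbreviation E :: "nat \<Rightarrow> int \<Rightarrow> ('a \<Rightarrow> real) \<Rightarrow> 'a \<Rightarrow> real" where
  "E q l \<equiv> real_cond_exp P (DF q l)"

abbreviation U :: "(nat \<Rightarrow> int) \<Rightarrow> ('a \<Rightarrow> real) \<Rightarrow> 'a \<Rightarrow> real" where
  "U \<equiv> koopman P d T"

lemma space_M: "space \<M> = space P"
  using subalg by (simp add: subalgebra_def)

lemma act_funcset: "act i \<in> space P \<rightarrow> space \<M>"
  using act_mem by (auto simp: space_M)

lemma sets_filt: "sets (F i) = {act i -` A \<inter> space P | A. A \<in> sets \<M>}"
  unfolding filt_def by (rule sets_vimage_algebra2[OF act_funcset])

lemma space_filt [simp]: "space (F i) = space P"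
  by (simp add: filt_def)

lemma subalgebra_filt: "subalgebra P (F i)"
  using subalg by (auto simp: subalgebra_def sets_filt)

text \<open>Monotonicity of \<open>\<M>\<close> along \<open>T q\<close> says that
  \<open>T q\<close> maps sets of \<open>\<M>\<close> to sets of \<open>\<M>\<close>, so the inverse
  of \<open>T q\<close> is measurable for \<open>\<M>\<close>. Nonpositive exponents use only these
  inverses.\<close>

lemma act_nonpos_measurable:
  assumes "\<And>q. q \<in> {1..d} \<Longrightarrow> k q \<le> 0"
  shows "act k \<in> \<M> \<rightarrow>\<^sub>M \<M>"
proof -
  have inv: "inv_into (space P) (T q) \<in> \<M> \<rightarrow>\<^sub>M \<M>" if q: "q \<in> {1..d}" for q
  proof (rule measurableI)
    fix x assume "x \<in> space \<M>"
    then show "inv_into (space P) (T q) x \<in> space \<M>"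
      using measurable_space[OF meas_inv[OF q]] by (simp add: space_M)
  next
    fix A assume "A \<in> sets \<M>"
    then have "A \<in> {T q -` B \<inter> space P | B. B \<in> sets \<M>}"
      using increasing[OF q] T_mem[OF q] by (subst (asm) sets_vimage_algebra2) (auto simp: space_M)
    then obtain B where B: "B \<in> sets \<M>" "A = T q -` B \<inter> space P" by auto
    \<comment> \<open>The preimage of \<open>A\<close> under the inverse is its image under
      \<open>T q\<close>, which is \<open>B\<close> because \<open>T q\<close> is onto.\<close>
    have "inv_into (space P) (T q) -` A \<inter> space \<M> = B"
      using bij[OF q] sets.sets_into_space[OF B(1)] B(2)
      by (auto simp: space_M bij_betw_def f_inv_into_f inv_into_into)
    then show "inv_into (space P) (T q) -` A \<inter> space \<M> \<in> sets \<M>" using B by simp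
  qed
  have pow: "inv_into (space P) (T q) ^^ n \<in> \<M> \<rightarrow>\<^sub>M \<M>" if "q \<in> {1..d}" for q n
  proof (induction n)
    case (Suc n)
    then show ?case unfolding funpow.simps by (rule measurable_comp[OF _ inv[OF that]])
  qed (simp add: id_def)
  show ?thesis
    unfolding action_def
  proof (rule comp_over_induct)
    fix q h assume "q \<in> {1..d}" and h: "h \<in> \<M> \<rightarrow>\<^sub>M \<M>"
    then have "int_funpow (space P) (T q) (k q) \<in> \<M> \<rightarrow>\<^sub>M \<M>"
      using pow[of q] assms[of q] by (cases "k q = 0") (auto simp: int_funpow_def)
    with h show "int_funpow (space P) (T q) (k q) \<circ> h \<in> \<M> \<rightarrow>\<^sub>M \<M>"
      by (rule measurable_comp)
  qed (auto simp: id_def)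
qed

text \<open>Write \<open>act i\<close> as \<open>act k\<close> after \<open>act j\<close>, where
  \<open>k = i - j\<close> is nonpositive: the preimage of a set of \<open>\<M>\<close> under
  \<open>act k\<close> is again in \<open>\<M>\<close>.\<close>

lemma filt_mono:
  assumes "\<And>q. q \<in> {1..d} \<Longrightarrow> i q \<le> j q"
  shows "sets (F i) \<subseteq> sets (F j)"
proof
  fix A assume "A \<in> sets (F i)"
  then obtain B where B: "B \<in> sets \<M>" "A = act i -` B \<inter> space P"
    by (auto simp: sets_filt)
  define k where "k = (\<lambda>q. i q - j q)"
  have "act k \<in> \<M> \<rightarrow>\<^sub>M \<M>"
    using assms by (intro act_nonpos_measurable) (auto simp: k_def)
  then have "act k -` B \<inter> space P \<in> sets \<M>"
    using measurable_sets[OF _ B(1), of "act k" \<M>] by (simp add: space_M)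
  moreover have "A = act j -` (act k -` B \<inter> space P) \<inter> space P"
    using B(2) by (auto simp: act_add act_mem k_def)
  ultimately show "A \<in> sets (F j)"
    unfolding sets_filt by blast
qed

lemma vimage_filt: "vimage_algebra (space P) (act j) (F i) = F (\<lambda>q. i q + j q)"
  unfolding filt_def
  by (subst vimage_algebra_vimage_algebra_eq) (auto intro!: vimage_algebra_cong simp: act_add act_mem space_M)

section \<open>Directional sigma-algebras and their generators\<close>

definition dir_gen :: "nat \<Rightarrow> int \<Rightarrow> 'a set set" where
  "dir_gen q l = (\<Union>i\<in>{i \<in> Zd d. i q \<le> l}. sets (F i))"

lemma dir_gen_Pow: "dir_gen q l \<subseteq> Pow (space P)"
  using sets.sets_into_space[of _ "F _"] by (fastforce simp: dir_gen_def)

lemma dir_filt_eq: "DF q l = sigma (space P) (dir_gen q l)"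
  by (simp add: dir_filt_def dir_gen_def)

lemma sets_dir_filt: "sets (DF q l) = sigma_sets (space P) (dir_gen q l)"
  using dir_gen_Pow by (simp add: dir_filt_eq)

lemma space_dir_filt [simp]: "space (DF q l) = space P"
  using dir_gen_Pow by (simp add: dir_filt_eq space_measure_of_conv)

text \<open>The filtration is directed: the coordinatewise maximum of two indices whose coordinate
  \<open>q\<close> is at most \<open>l\<close> is again such an index. Hence the union of these
  \<open>F i\<close> is a pi-system.\<close>

lemma Int_stable_dir_gen: "Int_stable (dir_gen q l)"
proof (rule Int_stableI)
  fix A B assume "A \<in> dir_gen q l" "B \<in> dir_gen q l"
  then obtain i j where ij: "i \<in> Zd d" "j \<in> Zd d" "i q \<le> l" "j q \<le> l" "A \<in> sets (F i)" "B \<in> sets (F j)"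
    by (auto simp: dir_gen_def)
  define k where "k = (\<lambda>r. max (i r) (j r))"
  have "k \<in> Zd d" "k q \<le> l" using ij by (auto simp: Zd_def k_def)
  moreover have "sets (F i) \<subseteq> sets (F k)" "sets (F j) \<subseteq> sets (F k)"
    by (auto intro!: filt_mono simp: k_def)
  ultimately show "A \<inter> B \<in> dir_gen q l"
    using ij by (auto simp: dir_gen_def)
qed

text \<open>Needs a genuine direction: for \<open>q\<close> outside \<open>{1..d}\<close> every
  index has entry 0 at \<open>q\<close>, so for \<open>l < 0\<close> the union is empty.\<close>

lemma space_in_dir_gen: "q \<in> {1..d} \<Longrightarrow> space P \<in> dir_gen q l"
proof -
  assume "q \<in> {1..d}"
  then have "(\<lambda>r. if r = q then l else 0) \<in> Zd d" by (auto simp: Zd_def)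
  moreover have "space P \<in> sets (F (\<lambda>r. if r = q then l else 0))"
    using sets.top[of "F _"] by simp
  ultimately show ?thesis
    unfolding dir_gen_def by fastforce
qed

lemma subalgebra_filt_dir: "i \<in> Zd d \<Longrightarrow> i q \<le> l \<Longrightarrow> subalgebra (DF q l) (F i)"
  by (auto simp: subalgebra_def sets_dir_filt dir_gen_def intro!: sigma_sets.Basic)

lemma subalgebra_dir: "subalgebra P (DF q l)"
proof -
  have "dir_gen q l \<subseteq> sets P"
    using subalgebra_filt by (auto simp: dir_gen_def subalgebra_def)
  then show ?thesis
    by (simp add: subalgebra_def sets_dir_filt sets.sigma_sets_subset)
qed

lemma subalgebra_dir_mono: "k \<le> l \<Longrightarrow> subalgebra (DF q l) (DF q k)"
proof -
  assume "k \<le> l"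
  then have "dir_gen q k \<subseteq> dir_gen q l" by (force simp: dir_gen_def)
  then show ?thesis
    by (simp add: subalgebra_def sets_dir_filt sigma_sets_mono')
qed

sublocale filt: finite_measure_subalgebra P "F i" for i
  by unfold_locales (rule subalgebra_filt)

sublocale dir: finite_measure_subalgebra P "DF q l" for q l
  by unfold_locales (rule subalgebra_dir)

text \<open>Pulling back by \<open>act j\<close> translates the index of every \<open>F i\<close> by
  \<open>j\<close>. This carries the half-space with bound \<open>l\<close> onto the one with bound
  \<open>l + j q\<close>, and pulling back commutes with generation.\<close>

lemma vimage_dir_filt:
  assumes j: "j \<in> Zd d"
  shows "vimage_algebra (space P) (act j) (DF q l) = DF q (l + j q)"
proof -
  have "{act j -` A \<inter> space P | A. A \<in> dir_gen q l} = dir_gen q (l + j q)"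
  proof -
    have *: "{act j -` A \<inter> space P | A. A \<in> sets (F i)} = sets (F (\<lambda>q. i q + j q))" for i
      unfolding vimage_filt[symmetric] by (rule sets_vimage_algebra2[symmetric]) (auto simp: act_mem)
    have "{act j -` A \<inter> space P | A. A \<in> dir_gen q l}
        = (\<Union>i\<in>{i \<in> Zd d. i q \<le> l}. {act j -` A \<inter> space P | A. A \<in> sets (F i)})"
      by (auto simp: dir_gen_def)
    also have "\<dots> = (\<Union>i\<in>{i \<in> Zd d. i q \<le> l}. sets (F (\<lambda>q. i q + j q)))"
      by (simp only: *)
    also have "\<dots> = (\<Union>i\<in>(\<lambda>i q. i q + j q) ` {i \<in> Zd d. i q \<le> l}. sets (F i))"
      by simp
    also have "(\<lambda>i q. i q + j q) ` {i \<in> Zd d. i q \<le> l} = {i \<in> Zd d. i q \<le> l + j q}"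
    proof (intro equalityI subsetI)
      fix i assume "i \<in> {i \<in> Zd d. i q \<le> l + j q}"
      then have "(\<lambda>r. i r - j r) \<in> {i \<in> Zd d. i q \<le> l}"
        using j by (auto simp: Zd_def)
      then show "i \<in> (\<lambda>i q. i q + j q) ` {i \<in> Zd d. i q \<le> l}"
        by (rule rev_image_eqI) simp
    qed (use j in \<open>auto simp: Zd_def\<close>)
    finally show ?thesis by (simp add: dir_gen_def)
  qed
  moreover have "act j \<in> space P \<rightarrow> space P" by (auto simp: act_mem)
  ultimately show ?thesis
    unfolding dir_filt_eq by (simp add: vimage_algebra_sigma dir_gen_Pow)
qed

lemma koopman_cond_exp:
  assumes "j \<in> Zd d" "integrable P g"
  shows "AE x in P. E q (l + j q) (U j g) x = U j (E q l g) x"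
  using real_cond_exp_comp_measure_preserving[OF prob_space_axioms act_measure_preserving subalgebra_dir assms(2), of j q l]
  by (simp add: vimage_dir_filt[OF assms(1)] koopman_def comp_def)

section \<open>Conditional expectations in two different directions\<close>

lemma set_integral_cong_AE_measurable:
  fixes u v :: "'a \<Rightarrow> real"
  assumes "AE x in P. u x = v x" "u \<in> borel_measurable P" "v \<in> borel_measurable P" "A \<in> sets P"
  shows "(LINT x:A|P. u x) = (LINT x:A|P. v x)"
  using assms by (intro set_lebesgue_integral_cong_AE) auto

lemma integral_mult_cong_AE:
  fixes u v g :: "'a \<Rightarrow> real"
  assumes "AE x in P. u x = v x" "u \<in> borel_measurable P" "v \<in> borel_measurable P" "g \<in> borel_measurable P"
  shows "(LINT x|P. u x * g x) = (LINT x|P. v x * g x)"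
proof (rule integral_cong_AE)
  show "AE x in P. u x * g x = v x * g x"
    using assms(1) by eventually_elim simp
qed (use assms in auto)

text \<open>Every generating set of \<open>DF q k\<close> lies in some \<open>F i\<close> with \<open>inf i j = j'\<close>, and there the commuting
  hypothesis applies.\<close>

lemma dir_cond_exp_indicator:
  fixes k :: int
  assumes q: "q \<in> {1..d}" and j: "j \<in> Zd d" and A: "A \<in> sets (F j)"
  defines "j' \<equiv> j(q := min (j q) k)"
  shows "AE x in P. E q k (indicator A) x = real_cond_exp P (F j') (indicator A) x"
proof -
  have [measurable]: "A \<in> sets P" using A subalgebra_filt by (auto simp: subalgebra_def)
  have ind: "integrable P (indicator A :: 'a \<Rightarrow> real)" by (simp add: integrable_indicator_iff less_top[symmetric])
  define v where "v = real_cond_exp P (F j') (indicator A)"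
  have v: "integrable P v" unfolding v_def by (rule filt.real_cond_exp_int(1)[OF ind])
  have j': "j' \<in> Zd d" "j' q \<le> k" using j q by (auto simp: Zd_def j'_def)
  have "AE x in P. E q k (indicator A) x = E q k v x"
  proof (rule dir.real_cond_exp_eq_generatorI[OF sets_dir_filt Int_stable_dir_gen dir_gen_Pow space_in_dir_gen[OF q] ind v])
    fix B assume "B \<in> dir_gen q k"
    then obtain i where i: "i \<in> Zd d" "i q \<le> k" "B \<in> sets (F i)" by (auto simp: dir_gen_def)
    \<comment> \<open>Raising \<open>i\<close> above \<open>j'\<close> keeps \<open>B\<close>
      measurable and makes the minimum with \<open>j\<close> computable: off \<open>q\<close> it is
      \<open>j\<close>, and at \<open>q\<close> it is \<open>min (j q) k\<close> because
      \<open>i q \<le> k\<close>.\<close>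
    define i' where "i' = (\<lambda>r. max (i r) (j' r))"
    have i': "i' \<in> Zd d" using i j' by (auto simp: Zd_def i'_def)
    have B: "B \<in> sets (F i')" using i(3) filt_mono[of i i'] by (auto simp: i'_def)
    then have [measurable]: "B \<in> sets P" using subalgebra_filt by (auto simp: subalgebra_def)
    have inf: "inf i' j = j'"
      using i(2) by (auto simp: fun_eq_iff inf_min i'_def j'_def)
    have "AE x in P. real_cond_exp P (F i') (indicator A) x = real_cond_exp P (F (inf i' j)) (indicator A) x"
    proof -
      have "(indicator A :: 'a \<Rightarrow> real) \<in> borel_measurable (F j)" using A by simp
      moreover have "bounded ((indicator A :: 'a \<Rightarrow> real) ` space P)"
        by (rule boundedI[of _ 1]) (auto simp: indicator_def)
      ultimately show ?thesis
        using commuting i' j unfolding commuting_filtration_def by blast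
    qed
    then have "AE x in P. real_cond_exp P (F i') (indicator A) x = v x"
      unfolding inf v_def .
    then have "(LINT x:B|P. real_cond_exp P (F i') (indicator A) x) = (LINT x:B|P. v x)"
      by (intro set_integral_cong_AE_measurable) (auto simp: v_def)
    then show "(LINT x:B|P. indicator A x) = (LINT x:B|P. v x)"
      using filt.real_cond_exp_intA[OF ind B] by simp
  qed
  moreover have "AE x in P. E q k v x = v x"
    using v measurable_from_subalg[OF subalgebra_filt_dir[OF j'], of v borel]
    by (intro dir.real_cond_exp_F_meas) (simp_all add: v_def)
  ultimately show ?thesis unfolding v_def by auto
qed

text \<open>Test on \<open>A\<close> in \<open>F j\<close> with \<open>j r \<le> l\<close>.
  Self-adjointness moves \<open>E q k\<close> to the indicator and produces \<open>v\<close>,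
  measurable for an index that differs from \<open>j\<close> in coordinate \<open>q\<close> only. As
  \<open>q\<close> is not \<open>r\<close>, \<open>v\<close> is still measurable at level
  \<open>l\<close> in direction \<open>r\<close>, so \<open>g\<close> may be replaced by
  \<open>E r l g\<close>.\<close>

lemma dir_cond_exp_absorb:
  assumes q: "q \<in> {1..d}" and r: "r \<in> {1..d}" and qr: "q \<noteq> r" and g: "g \<in> L2 P P"
  shows "AE x in P. E r l (E q k g) x = E r l (E q k (E r l g)) x"
proof (rule dir.real_cond_exp_eq_generatorI[OF sets_dir_filt Int_stable_dir_gen dir_gen_Pow space_in_dir_gen[OF r]])
  show "integrable P (E q k g)" "integrable P (E q k (E r l g))"
    by (intro L2_integrable dir.real_cond_exp_L2 g)+
next
  fix A assume "A \<in> dir_gen r l"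
  then obtain j where j: "j \<in> Zd d" "j r \<le> l" and A: "A \<in> sets (F j)" by (auto simp: dir_gen_def)
  have A_P: "A \<in> sets P" using A subalgebra_filt by (auto simp: subalgebra_def)
  define j' where "j' = j(q := min (j q) k)"
  have j': "j' \<in> Zd d" "j' r \<le> l" using j q qr by (auto simp: Zd_def j'_def)
  define v where "v = real_cond_exp P (F j') (indicator A)"
  have v_L2: "v \<in> L2 P P" unfolding v_def by (intro filt.real_cond_exp_L2 L2_indicator A_P)
  have v_meas: "v \<in> borel_measurable (DF r l)"
    unfolding v_def by (rule measurable_from_subalg[OF subalgebra_filt_dir[OF j']]) simp
  have *: "(LINT x:A|P. E q k w x) = (LINT x|P. v x * w x)" if w: "w \<in> L2 P P" for w
  proof -
    have "(LINT x:A|P. E q k w x) = (LINT x|P. indicator A x * E q k w x)"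
      by (simp add: set_lebesgue_integral_def)
    also have "\<dots> = (LINT x|P. E q k (indicator A) x * w x)"
      by (rule dir.real_cond_exp_self_adjoint[OF L2_indicator[OF A_P] w])
    also have "\<dots> = (LINT x|P. v x * w x)"
      using dir_cond_exp_indicator[OF q j(1) A, of k] L2_self_measurable[OF w]
      by (intro integral_mult_cong_AE) (auto simp: v_def j'_def)
    finally show ?thesis .
  qed
  show "(LINT x:A|P. E q k g x) = (LINT x:A|P. E q k (E r l g) x)"
    unfolding *[OF g] *[OF dir.real_cond_exp_L2[OF g]]
    by (rule dir.real_cond_exp_intg(2)[symmetric, OF L2_mult_integrable[OF v_L2 g] v_meas L2_self_measurable[OF g]])
qed

text \<open>Absorption with the roles exchanged gives
  \<open>E q k E r l = E q k E r l E q k\<close>. The right side is self-adjoint, so the left side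
  equals its own adjoint \<open>E r l E q k\<close>. The computation tests this on indicators of all
  events.\<close>

lemma dir_cond_exp_commute:
  assumes q: "q \<in> {1..d}" and r: "r \<in> {1..d}" and qr: "q \<noteq> r" and g: "g \<in> L2 P P"
  shows "AE x in P. E r l (E q k g) x = E q k (E r l g) x"
proof (rule density_unique_real)
  show "integrable P (E r l (E q k g))" "integrable P (E q k (E r l g))"
    by (intro L2_integrable dir.real_cond_exp_L2 g)+
next
  fix A assume A: "A \<in> sets P"
  note L2s = L2_indicator[OF A] g dir.real_cond_exp_L2
  note adj = dir.real_cond_exp_self_adjoint
  have "(LINT x|P. indicator A x * E r l (E q k g) x) = (LINT x|P. E q k (E r l (indicator A)) x * g x)"
    by (simp add: adj L2s)
  also have "\<dots> = (LINT x|P. E q k (E r l (E q k (indicator A))) x * g x)"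
    using dir_cond_exp_absorb[OF r q qr[symmetric] L2_indicator[OF A]] L2_self_measurable[OF g]
    by (intro integral_mult_cong_AE) auto
  also have "\<dots> = (LINT x|P. indicator A x * E q k (E r l (E q k g)) x)"
    by (simp add: adj L2s)
  also have "\<dots> = (LINT x|P. indicator A x * E q k (E r l g) x)"
    unfolding mult.commute[of "indicator A _"]
    using dir_cond_exp_absorb[OF r q qr[symmetric] g] A
    by (intro integral_mult_cong_AE[symmetric]) auto
  finally show "(LINT x:A|P. E r l (E q k g) x) = (LINT x:A|P. E q k (E r l g) x)"
    by (simp add: set_lebesgue_integral_def)
qed

end

section \<open>Operators on square integrable functions\<close>

text \<open>Encodes additive maps of \<open>L2\<close> classes, realised on representatives: the
  second clause is well-definedness modulo null sets. The rules for zero, differences and finite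
  sums are derived from it and additivity.\<close>

definition L2_op :: "'a measure \<Rightarrow> (('a \<Rightarrow> real) \<Rightarrow> 'a \<Rightarrow> real) \<Rightarrow> bool" where
  "L2_op M A \<longleftrightarrow>
     (\<forall>g\<in>L2 M M. A g \<in> L2 M M) \<and>
     (\<forall>g\<in>L2 M M. \<forall>h\<in>L2 M M. (AE x in M. g x = h x) \<longrightarrow> (AE x in M. A g x = A h x)) \<and>
     (\<forall>g\<in>L2 M M. \<forall>h\<in>L2 M M. AE x in M. A (\<lambda>x. g x + h x) x = A g x + A h x)"

definition L2_commute ::
  "'a measure \<Rightarrow> (('a \<Rightarrow> real) \<Rightarrow> 'a \<Rightarrow> real) \<Rightarrow> (('a \<Rightarrow> real) \<Rightarrow> 'a \<Rightarrow> real) \<Rightarrow> bool" where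
  "L2_commute M A B \<longleftrightarrow> (\<forall>g\<in>L2 M M. AE x in M. A (B g) x = B (A g) x)"

lemma L2_op_mem: "L2_op M A \<Longrightarrow> g \<in> L2 M M \<Longrightarrow> A g \<in> L2 M M"
  unfolding L2_op_def by blast

lemma L2_op_cong:
  "L2_op M A \<Longrightarrow> g \<in> L2 M M \<Longrightarrow> h \<in> L2 M M \<Longrightarrow> AE x in M. g x = h x \<Longrightarrow> AE x in M. A g x = A h x"
  unfolding L2_op_def by blast

lemma L2_op_add:
  "L2_op M A \<Longrightarrow> g \<in> L2 M M \<Longrightarrow> h \<in> L2 M M \<Longrightarrow> AE x in M. A (\<lambda>x. g x + h x) x = A g x + A h x"
  unfolding L2_op_def by blast

text \<open>If \<open>g\<close> vanishes almost everywhere, then \<open>g + g\<close> and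
  \<open>g\<close> agree almost everywhere, so \<open>A g + A g = A g\<close>.\<close>

lemma L2_op_zero:
  assumes A: "L2_op M A" and g: "g \<in> L2 M M" "AE x in M. g x = 0"
  shows "AE x in M. A g x = 0"
proof -
  have "AE x in M. A (\<lambda>x. g x + g x) x = A g x"
    using g by (intro L2_op_cong[OF A] L2_add) auto
  with L2_op_add[OF A g(1) g(1)] show ?thesis
    by eventually_elim simp
qed

lemma L2_op_diff:
  assumes A: "L2_op M A" and g: "g \<in> L2 M M" and h: "h \<in> L2 M M"
  shows "AE x in M. A (\<lambda>x. g x - h x) x = A g x - A h x"
  using L2_op_add[OF A L2_diff[OF g h] h] by eventually_elim simp

lemma L2_op_sum:
  assumes A: "L2_op M A" and g: "\<And>i. i \<in> I \<Longrightarrow> g i \<in> L2 M M"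
  shows "AE x in M. A (\<lambda>x. \<Sum>i\<in>I. g i x) x = (\<Sum>i\<in>I. A (g i) x)"
  using g
proof (induction I rule: infinite_finite_induct)
  case (insert i I)
  have "AE x in M. A (\<lambda>x. g i x + (\<Sum>i\<in>I. g i x)) x = A (g i) x + A (\<lambda>x. \<Sum>i\<in>I. g i x) x"
    by (intro L2_op_add[OF A] L2_sum insert.prems) auto
  moreover have "AE x in M. A (\<lambda>x. \<Sum>i\<in>I. g i x) x = (\<Sum>i\<in>I. A (g i) x)"
    by (intro insert.IH insert.prems) simp
  ultimately show ?case
    unfolding sum.insert[OF insert.hyps] by eventually_elim (simp only:)
next
  case empty
  show ?case
    unfolding sum.empty by (rule L2_op_zero[OF A L2_zero]) simp
next
  case (infinite I)
  show ?case
    unfolding sum.infinite[OF infinite.hyps] by (rule L2_op_zero[OF A L2_zero]) simp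
qed

lemma L2_op_id: "L2_op M id"
  by (simp add: L2_op_def)

lemma L2_op_comp:
  assumes A: "L2_op M A" and B: "L2_op M B"
  shows "L2_op M (\<lambda>g. A (B g))"
  unfolding L2_op_def
proof (intro conjI ballI impI)
  fix g h assume gh: "g \<in> L2 M M" "h \<in> L2 M M"
  note mem = L2_op_mem[OF B gh(1)] L2_op_mem[OF B gh(2)]
  have "AE x in M. A (B (\<lambda>x. g x + h x)) x = A (\<lambda>x. B g x + B h x) x"
    using gh by (intro L2_op_cong[OF A] L2_op_add[OF B] L2_op_mem[OF B] L2_add)
  with L2_op_add[OF A mem] show "AE x in M. A (B (\<lambda>x. g x + h x)) x = A (B g) x + A (B h) x"
    by eventually_elim simp
  show "AE x in M. A (B g) x = A (B h) x" if "AE x in M. g x = h x"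
    by (rule L2_op_cong[OF A mem L2_op_cong[OF B gh that]])
qed (intro L2_op_mem[OF A] L2_op_mem[OF B])

lemma L2_op_minus:
  assumes A: "L2_op M A" and B: "L2_op M B"
  shows "L2_op M (\<lambda>g x. A g x - B g x)"
  unfolding L2_op_def
proof (intro conjI ballI impI)
  fix g h assume gh: "g \<in> L2 M M" "h \<in> L2 M M"
  show "AE x in M. A g x - B g x = A h x - B h x" if "AE x in M. g x = h x"
    using L2_op_cong[OF A gh that] L2_op_cong[OF B gh that] by eventually_elim simp
  show "AE x in M. A (\<lambda>x. g x + h x) x - B (\<lambda>x. g x + h x) x = A g x - B g x + (A h x - B h x)"
    using L2_op_add[OF A gh] L2_op_add[OF B gh] by eventually_elim simp
qed (intro L2_diff L2_op_mem[OF A] L2_op_mem[OF B])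

lemma L2_op_sum_ops:
  assumes "finite I" and A: "\<And>i. i \<in> I \<Longrightarrow> L2_op M (A i)"
  shows "L2_op M (\<lambda>g x. \<Sum>i\<in>I. A i g x)"
  unfolding L2_op_def
proof (intro conjI ballI impI)
  fix g h assume gh: "g \<in> L2 M M" "h \<in> L2 M M"
  show "AE x in M. (\<Sum>i\<in>I. A i g x) = (\<Sum>i\<in>I. A i h x)" if "AE x in M. g x = h x"
  proof -
    have "AE x in M. \<forall>i\<in>I. A i g x = A i h x"
      using assms(1) by (intro AE_finite_allI L2_op_cong[OF A gh that])
    then show ?thesis by eventually_elim (blast intro: sum.cong)
  qed
  have "AE x in M. \<forall>i\<in>I. A i (\<lambda>x. g x + h x) x = A i g x + A i h x"
    using assms(1) by (intro AE_finite_allI L2_op_add[OF A gh])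
  then show "AE x in M. (\<Sum>i\<in>I. A i (\<lambda>x. g x + h x) x) = (\<Sum>i\<in>I. A i g x) + (\<Sum>i\<in>I. A i h x)"
    unfolding sum.distrib[symmetric] by eventually_elim (blast intro: sum.cong)
qed (intro L2_sum L2_op_mem[OF A])

lemma L2_op_comp_over:
  assumes "finite S" "\<And>q. q \<in> S \<Longrightarrow> L2_op M (A q)"
  shows "L2_op M (comp_over S A)"
proof (rule comp_over_induct[where Q = "L2_op M"])
  fix q h assume "q \<in> S" "L2_op M h"
  then show "L2_op M (A q \<circ> h)"
    using L2_op_comp[OF assms(2), of q h] by (simp add: comp_def)
qed (rule assms(1) L2_op_id)+

lemma L2_commuteD: "L2_commute M A B \<Longrightarrow> g \<in> L2 M M \<Longrightarrow> AE x in M. A (B g) x = B (A g) x"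
  by (simp add: L2_commute_def)

lemma L2_commute_sym: "L2_commute M A B \<Longrightarrow> L2_commute M B A"
  unfolding L2_commute_def by (rule ballI, rule AE_symmetric, drule (1) bspec)

lemma L2_commute_comp:
  assumes A: "L2_op M A" and B: "L2_op M B" and C: "L2_op M C"
    and AC: "L2_commute M A C" and BC: "L2_commute M B C"
  shows "L2_commute M (\<lambda>g. A (B g)) C"
  unfolding L2_commute_def
proof
  fix g assume g: "g \<in> L2 M M"
  have "AE x in M. A (B (C g)) x = A (C (B g)) x"
    using L2_commuteD[OF BC g] g by (intro L2_op_cong[OF A] L2_op_mem[OF B] L2_op_mem[OF C])
  with L2_commuteD[OF AC L2_op_mem[OF B g]]
  show "AE x in M. A (B (C g)) x = C (A (B g)) x" by eventually_elim simp
qed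

lemma L2_commute_minus:
  assumes A: "L2_op M A" and B: "L2_op M B" and C: "L2_op M C"
    and AC: "L2_commute M A C" and BC: "L2_commute M B C"
  shows "L2_commute M (\<lambda>g x. A g x - B g x) C"
  unfolding L2_commute_def
proof
  fix g assume g: "g \<in> L2 M M"
  show "AE x in M. A (C g) x - B (C g) x = C (\<lambda>x. A g x - B g x) x"
    using L2_commuteD[OF AC g] L2_commuteD[OF BC g] L2_op_diff[OF C L2_op_mem[OF A g] L2_op_mem[OF B g]]
    by eventually_elim simp
qed

lemma L2_commute_sum_ops:
  assumes "finite I" and A: "\<And>i. i \<in> I \<Longrightarrow> L2_op M (A i)" and C: "L2_op M C"
    and AC: "\<And>i. i \<in> I \<Longrightarrow> L2_commute M (A i) C"
  shows "L2_commute M (\<lambda>g x. \<Sum>i\<in>I. A i g x) C"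
  unfolding L2_commute_def
proof
  fix g assume g: "g \<in> L2 M M"
  have "AE x in M. \<forall>i\<in>I. A i (C g) x = C (A i g) x"
    using assms(1) by (intro AE_finite_allI L2_commuteD[OF AC g])
  moreover have "AE x in M. C (\<lambda>x. \<Sum>i\<in>I. A i g x) x = (\<Sum>i\<in>I. C (A i g) x)"
    by (intro L2_op_sum[OF C] L2_op_mem[OF A g])
  ultimately show "AE x in M. (\<Sum>i\<in>I. A i (C g) x) = C (\<lambda>x. \<Sum>i\<in>I. A i g x) x"
    by eventually_elim (simp only: cong: sum.cong)
qed

lemma L2_commute_comp_over:
  assumes "finite S" and C: "L2_op M C"
    and A: "\<And>q. q \<in> S \<Longrightarrow> L2_op M (A q)" "\<And>q. q \<in> S \<Longrightarrow> L2_commute M (A q) C"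
  shows "L2_commute M (comp_over S A) C"
proof -
  have "L2_op M (comp_over S A) \<and> L2_commute M (comp_over S A) C"
  proof (rule comp_over_induct[where Q = "\<lambda>h. L2_op M h \<and> L2_commute M h C"])
    show "L2_op M id \<and> L2_commute M id C"
      by (simp add: L2_op_def L2_commute_def)
    fix q h assume "q \<in> S" "L2_op M h \<and> L2_commute M h C"
    then show "L2_op M (A q \<circ> h) \<and> L2_commute M (A q \<circ> h) C"
      using L2_op_comp[OF A(1), of q h] L2_commute_comp[OF A(1) _ C A(2), of q h] by (simp add: comp_def)
  qed fact
  then show ?thesis ..
qed

text \<open>Either the annihilating factor is the one applied first, or commutation lets it also
  annihilate the image under the first one, and the induction continues with that image.\<close>

lemma comp_over_AE_zero:
  assumes A: "\<And>q. q \<in> {1..n} \<Longrightarrow> L2_op M (A q)"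
    and com: "\<And>q r. q \<in> {1..n} \<Longrightarrow> r \<in> {1..n} \<Longrightarrow> q \<noteq> r \<Longrightarrow> L2_commute M (A q) (A r)"
    and g: "g \<in> L2 M M" and q: "q \<in> {1..n}" "AE x in M. A q g x = 0"
  shows "AE x in M. comp_over {1..n} A g x = 0"
  using assms
proof (induction n arbitrary: g)
  case 0
  from 0(4) show ?case by simp
next
  case (Suc n)
  note A = Suc.prems(1) and com = Suc.prems(2) and g = Suc.prems(3) and q = Suc.prems(4,5)
  have AS: "L2_op M (A (Suc n))" by (rule A) simp
  have mem: "A (Suc n) g \<in> L2 M M"
    by (rule L2_op_mem[OF AS g])
  have A': "L2_op M (A r)" if "r \<in> {1..n}" for r
    using that by (intro A) simp
  have com': "L2_commute M (A r) (A s)" if "r \<in> {1..n}" "s \<in> {1..n}" "r \<noteq> s" for r s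
    using that by (intro com) auto
  show ?case
  proof (cases "q = Suc n")
    case True
    have "L2_op M (comp_over {1..n} A)" by (intro L2_op_comp_over A') auto
    then show ?thesis
      unfolding comp_over_Suc comp_apply using mem q(2)[unfolded True] by (rule L2_op_zero)
  next
    case False
    then have qn: "q \<in> {1..n}" using q(1) by auto
    have "L2_commute M (A q) (A (Suc n))"
      using q False by (intro com) auto
    from L2_commuteD[OF this g] L2_op_zero[OF AS L2_op_mem[OF A'[OF qn] g] q(2)]
    have "AE x in M. A q (A (Suc n) g) x = 0" by eventually_elim simp
    with A' com' mem qn show ?thesis
      unfolding comp_over_Suc comp_apply by (rule Suc.IH)
  qed
qed

section \<open>The decomposition\<close>

lemma sum_telescope_int:
  fixes a :: "int \<Rightarrow> real"
  assumes "m \<le> n"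
  shows "(\<Sum>l\<in>{m..<n}. a (l + 1) - a l) = a n - a m"
  using assms
proof (induction n rule: int_ge_induct)
  case (step i)
  then have "{m..<i + 1} = insert i {m..<i}" by auto
  with step show ?case by simp
qed simp

definition axis_vec :: "nat \<Rightarrow> int \<Rightarrow> nat \<Rightarrow> int" where
  "axis_vec q l = (\<lambda>r. if r = q then l else 0)"

lemma axis_vec_Zd: "q \<in> {1..d} \<Longrightarrow> axis_vec q l \<in> Zd d"
  by (auto simp: axis_vec_def Zd_def)

lemma axis_vec_simps [simp]: "axis_vec q l q = l" "r \<noteq> q \<Longrightarrow> axis_vec q l r = 0"
  by (simp_all add: axis_vec_def)

lemma unit_vec_eq: "unit_vec q = axis_vec q 1"
  by (simp add: unit_vec_def axis_vec_def)

text \<open>A point of the larger box is a point of the smaller one plus a vector along the new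
  axis. The summand uses a sum of index vectors so that it matches the composition rule
  \<open>U_add\<close>.\<close>

lemma sum_PiE_dflt_Suc:
  fixes F :: "(nat \<Rightarrow> int) \<Rightarrow> real"
  shows "(\<Sum>k\<in>PiE_dflt {1..Suc n} 0 (\<lambda>_. L). F k)
    = (\<Sum>j\<in>PiE_dflt {1..n} 0 (\<lambda>_. L). \<Sum>l\<in>L. F (\<lambda>r. axis_vec (Suc n) l r + j r))"
proof -
  let ?box = "\<lambda>n. PiE_dflt {1..n} (0::int) (\<lambda>_. L)"
  have box_iff: "j \<in> ?box m \<longleftrightarrow> (\<forall>r. if r \<in> {1..m} then j r \<in> L else j r = 0)" for m j
    unfolding PiE_dflt_def by simp
  have upd: "(\<lambda>r. axis_vec (Suc n) l r + j r) = j(Suc n := l)" if j: "j \<in> ?box n" for j l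
  proof -
    have "j (Suc n) = 0" using j[unfolded box_iff, rule_format, of "Suc n"] by simp
    then show ?thesis by (simp add: axis_vec_def fun_eq_iff)
  qed
  have "(\<Sum>k\<in>?box (Suc n). F k) = (\<Sum>(j, l)\<in>?box n \<times> L. F (j(Suc n := l)))"
  proof (rule sum.reindex_bij_witness[where i = "\<lambda>(j, l). j(Suc n := l)" and j = "\<lambda>k. (k(Suc n := 0), k (Suc n))"])
    fix k assume k: "k \<in> ?box (Suc n)"
    show "(case (k(Suc n := 0), k (Suc n)) of (j, l) \<Rightarrow> j(Suc n := l)) = k" by simp
    have "k(Suc n := 0) \<in> ?box n"
      unfolding box_iff
    proof
      fix r show "if r \<in> {1..n} then (k(Suc n := 0)) r \<in> L else (k(Suc n := 0)) r = 0"
        using k[unfolded box_iff, rule_format, of r] by (auto split: if_splits)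
    qed
    moreover have "k (Suc n) \<in> L" using k[unfolded box_iff, rule_format, of "Suc n"] by simp
    ultimately show "(k(Suc n := 0), k (Suc n)) \<in> ?box n \<times> L" by blast
    show "(case (k(Suc n := 0), k (Suc n)) of (j, l) \<Rightarrow> F (j(Suc n := l))) = F k" by simp
  next
    fix p assume "p \<in> ?box n \<times> L"
    then obtain j l where p: "p = (j, l)" "j \<in> ?box n" "l \<in> L" by blast
    have "j (Suc n) = 0" using p(2)[unfolded box_iff, rule_format, of "Suc n"] by simp
    then show "((case p of (j, l) \<Rightarrow> j(Suc n := l))(Suc n := 0), (case p of (j, l) \<Rightarrow> j(Suc n := l)) (Suc n)) = p"
      using p(1) by (simp add: fun_upd_idem)
    show "(case p of (j, l) \<Rightarrow> j(Suc n := l)) \<in> ?box (Suc n)"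
      unfolding p(1) prod.case box_iff
    proof
      fix r show "if r \<in> {1..Suc n} then (j(Suc n := l)) r \<in> L else (j(Suc n := l)) r = 0"
        using p(2)[unfolded box_iff, rule_format, of r] p(3) by (auto split: if_splits)
    qed
  qed
  also have "\<dots> = (\<Sum>j\<in>?box n. \<Sum>l\<in>L. F (j(Suc n := l)))"
    by (simp only: sum.cartesian_product)
  also have "\<dots> = (\<Sum>j\<in>?box n. \<Sum>l\<in>L. F (\<lambda>r. axis_vec (Suc n) l r + j r))"
    by (intro sum.cong refl) (simp only: upd)
  finally show ?thesis .
qed

section \<open>Shifts, conditional expectations and martingale differences as operators\<close>

context completely_commuting
begin

lemma U_add: "x \<in> space P \<Longrightarrow> U i (U j g) x = U (\<lambda>q. i q + j q) g x"
  by (simp add: koopman_def act_add add.commute)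

lemma U_L2:
  assumes g: "g \<in> L2 P P"
  shows "U i g \<in> L2 P P"
proof -
  have "integrable (distr P P (act i)) (\<lambda>x. (g x)\<^sup>2)"
    using g by (simp add: distr_act L2_self_iff)
  then have "integrable P (\<lambda>x. (g (act i x))\<^sup>2)"
    using g by (subst (asm) integrable_distr_eq) (auto simp: L2_self_iff)
  then show ?thesis
    using g by (auto simp: L2_self_iff koopman_def)
qed

lemma U_AE: "AE x in P. Q x \<Longrightarrow> AE x in P. Q (act i x)"
  using AE_distrD[OF act_measurable[of i], of Q] unfolding distr_act by blast

lemma U_op: "L2_op P (U i)"
  unfolding L2_op_def
proof (intro conjI ballI impI)
  fix g h :: "'a \<Rightarrow> real" assume "AE x in P. g x = h x"
  from U_AE[OF this] show "AE x in P. U i g x = U i h x"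
    by (simp add: koopman_def)
qed (simp_all add: U_L2, simp add: koopman_def)

lemma E_op: "L2_op P (E q l)"
  unfolding L2_op_def
proof (intro conjI ballI impI)
  fix g h assume gh: "g \<in> L2 P P" "h \<in> L2 P P"
  show "AE x in P. E q l g x = E q l h x" if "AE x in P. g x = h x"
    by (intro dir.real_cond_exp_cong that L2_self_measurable gh)
  show "AE x in P. E q l (\<lambda>x. g x + h x) x = E q l g x + E q l h x"
    by (intro dir.real_cond_exp_add L2_integrable gh)
qed (rule dir.real_cond_exp_L2)

lemma E_E_commute:
  "q \<in> {1..d} \<Longrightarrow> r \<in> {1..d} \<Longrightarrow> q \<noteq> r \<Longrightarrow> L2_commute P (E q k) (E r l)"
  unfolding L2_commute_def by (intro ballI dir_cond_exp_commute) auto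

lemma U_U_commute: "L2_commute P (U i) (U j)"
  unfolding L2_commute_def by (auto intro!: AE_I2 simp: U_add add.commute)

lemma U_E:
  assumes "j \<in> Zd d" "g \<in> L2 P P"
  shows "AE x in P. U j (E q l g) x = E q (l + j q) (U j g) x"
  by (rule AE_symmetric[OF koopman_cond_exp[OF assms(1) L2_integrable[OF assms(2)]]])

lemma U_E_commute: "j \<in> Zd d \<Longrightarrow> j q = 0 \<Longrightarrow> L2_commute P (U j) (E q l)"
  unfolding L2_commute_def using U_E[of j _ q l] by auto

lemma E_E_tower:
  assumes g: "g \<in> L2 P P"
  shows "k \<le> l \<Longrightarrow> AE x in P. E q k (E q l g) x = E q k g x"
    and "k \<le> l \<Longrightarrow> AE x in P. E q l (E q k g) x = E q k g x"
proof -
  assume kl: "k \<le> l"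
  show "AE x in P. E q k (E q l g) x = E q k g x"
    by (intro dir.real_cond_exp_nested_subalg subalgebra_dir subalgebra_dir_mono kl L2_integrable g)
  show "AE x in P. E q l (E q k g) x = E q k g x"
    by (intro dir.real_cond_exp_F_meas dir.real_cond_exp_int(1) L2_integrable g
        measurable_from_subalg[OF subalgebra_dir_mono[OF kl]]) simp
qed

abbreviation D :: "nat \<Rightarrow> int \<Rightarrow> ('a \<Rightarrow> real) \<Rightarrow> 'a \<Rightarrow> real" where
  "D \<equiv> dir_proj P d T \<M>"

lemma D_eq: "D q l = (\<lambda>g x. E q l g x - E q (l - 1) g x)"
  by (simp add: dir_proj_def fun_eq_iff)

lemma D_op: "L2_op P (D q l)"
  unfolding D_eq by (intro L2_op_minus E_op)

lemma D_commute:
  assumes C: "L2_op P C" "\<And>l. L2_commute P (E q l) C"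
  shows "L2_commute P (D q l) C"
  unfolding D_eq by (intro L2_commute_minus E_op assms)

lemma E_D:
  assumes g: "g \<in> L2 P P"
  shows "AE x in P. E q 0 (D q 0 g) x = D q 0 g x"
    and "AE x in P. E q (-1) (D q 0 g) x = 0"
proof -
  have *: "AE x in P. E q l (D q 0 g) x = E q l (E q 0 g) x - E q l (E q (-1) g) x" for l
    unfolding D_eq using L2_op_diff[OF E_op L2_op_mem[OF E_op g] L2_op_mem[OF E_op g], of q l q 0 q "-1"]
    by simp
  show "AE x in P. E q 0 (D q 0 g) x = D q 0 g x"
    using *[of 0] E_E_tower[OF g, of 0 0 q] E_E_tower[OF g, of "-1" 0 q] by (auto simp: D_eq)
  show "AE x in P. E q (-1) (D q 0 g) x = 0"
    using *[of "-1"] E_E_tower[OF g, of "-1" "-1" q] E_E_tower[OF g, of "-1" 0 q] by auto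
qed

text \<open>The geometric sum for the formal quotient of \<open>U\<^sup>m - I\<close> by \<open>I - U\<close>, \<open>m\<close> of either sign; one of
  the two sums is always empty.\<close>

definition V :: "nat \<Rightarrow> int \<Rightarrow> ('a \<Rightarrow> real) \<Rightarrow> 'a \<Rightarrow> real" where
  "V q m g = (\<lambda>x. (\<Sum>i\<in>{m..<0}. U (axis_vec q i) g x) - (\<Sum>i\<in>{0..<m}. U (axis_vec q i) g x))"

lemma V_coboundary:
  assumes x: "x \<in> space P"
  shows "V q m g x - U (unit_vec q) (V q m g) x = U (axis_vec q m) g x - g x"
proof -
  define a where "a = (\<lambda>i. U (axis_vec q i) g x)"
  \<comment> \<open>Moving the point by \<open>act (unit_vec q)\<close> raises the exponent by one,
    so the coboundary of \<open>V q m g\<close> telescopes.\<close>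
  have shift: "U (axis_vec q i) g (act (unit_vec q) x) = a (i + 1)" for i
  proof -
    have "(\<lambda>r. axis_vec q i r + unit_vec q r) = axis_vec q (i + 1)"
      by (auto simp: unit_vec_eq axis_vec_def)
    then show ?thesis
      using act_add[OF x, of "axis_vec q i" "unit_vec q"] by (simp add: a_def koopman_def)
  qed
  have "V q m g x - U (unit_vec q) (V q m g) x
      = (\<Sum>i\<in>{0..<m}. a (i + 1) - a i) - (\<Sum>i\<in>{m..<0}. a (i + 1) - a i)"
    by (simp add: V_def koopman_def[of P d T "unit_vec q"] shift sum_subtractf) (simp add: a_def)
  also have "\<dots> = a m - a 0"
    by (cases "m \<ge> 0") (simp_all add: sum_telescope_int)
  also have "a 0 = g x"
    by (simp add: a_def koopman_def act_eq_id axis_vec_def)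
  finally show ?thesis by (simp add: a_def)
qed

lemma V_op: "L2_op P (V q m)"
  unfolding V_def by (intro L2_op_minus L2_op_sum_ops U_op) auto

text \<open>Term \<open>l\<close> is the increment of \<open>g\<close> at level \<open>- l\<close>,
  shifted to level 0. Over the half-open range \<open>- l\<close> runs through the levels from
  \<open>1 - M\<close> to \<open>M\<close>, whose increments add up to
  \<open>E q M g - E q (- M) g\<close>.\<close>

definition A :: "nat \<Rightarrow> nat \<Rightarrow> ('a \<Rightarrow> real) \<Rightarrow> 'a \<Rightarrow> real" where
  "A M q g = (\<lambda>x. \<Sum>l\<in>{- int M..<int M}. D q 0 (U (axis_vec q l) g) x)"

text \<open>With \<open>w = D q 0 (U (axis_vec q l) g)\<close>, the increment of \<open>g\<close> at
  level \<open>- l\<close> is the shift of \<open>w\<close> by \<open>- l\<close>, and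
  \<open>V q (- l) w\<close> is a function whose coboundary is that increment minus
  \<open>w\<close>.\<close>

definition B :: "nat \<Rightarrow> nat \<Rightarrow> ('a \<Rightarrow> real) \<Rightarrow> 'a \<Rightarrow> real" where
  "B M q g = (\<lambda>x. \<Sum>l\<in>{- int M..<int M}. V q (- l) (D q 0 (U (axis_vec q l) g)) x)"

lemma A_op: "L2_op P (A M q)"
  unfolding A_def by (rule L2_op_sum_ops) (auto intro: L2_op_comp[OF D_op U_op])

lemma B_op: "L2_op P (B M q)"
  unfolding B_def by (rule L2_op_sum_ops) (auto intro: L2_op_comp[OF V_op L2_op_comp[OF D_op U_op]])

context
  fixes C q
  assumes C: "L2_op P C" "\<And>l. L2_commute P (E q l) C" "\<And>l. L2_commute P (U (axis_vec q l)) C"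
begin

text \<open>\<open>A M q\<close> is assembled from conditional expectations and shifts in direction
  \<open>q\<close> alone. In the applications \<open>C\<close> is a conditional expectation in
  another direction or a shift \<open>U j\<close> with \<open>j q = 0\<close>.\<close>

lemma A_commute: "L2_commute P (A M q) C"
  unfolding A_def
  by (rule L2_commute_sum_ops)
    (auto intro!: C L2_op_comp[OF D_op U_op] L2_commute_comp[OF D_op U_op C(1) D_commute[OF C(1,2)] C(3)])

lemma V_commute: "L2_commute P (V q m) C"
  unfolding V_def by (intro L2_commute_minus L2_commute_sum_ops L2_op_sum_ops U_op C) auto

lemma B_commute: "L2_commute P (B M q) C"
  unfolding B_def
  by (rule L2_commute_sum_ops)
    (auto intro!: C L2_op_comp[OF V_op L2_op_comp[OF D_op U_op]]
      L2_commute_comp[OF V_op L2_op_comp[OF D_op U_op] C(1) V_commute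
        L2_commute_comp[OF D_op U_op C(1) D_commute[OF C(1,2)] C(3)]])

end

lemma A_B_commute_E:
  assumes "q \<in> {1..d}" "r \<in> {1..d}" "q \<noteq> r"
  shows "L2_commute P (A M q) (E r l)" "L2_commute P (B M q) (E r l)"
  using assms axis_vec_Zd[OF assms(1)]
  by (auto intro!: A_commute B_commute E_op E_E_commute U_E_commute)

text \<open>Each summand of \<open>A\<close> is a martingale difference at level 0. This is the
  source of the orthogonality required of \<open>h S\<close> in the directions of
  \<open>S\<close>.\<close>

lemma E_A:
  assumes g: "g \<in> L2 P P"
  shows "AE x in P. E q 0 (A M q g) x = A M q g x"
    and "AE x in P. E q (-1) (A M q g) x = 0"
proof -
  let ?u = "\<lambda>l. D q 0 (U (axis_vec q l) g)" and ?L = "{- int M..<int M}"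
  have u: "?u l \<in> L2 P P" for l by (intro L2_op_mem[OF D_op] U_L2 g)
  have *: "AE x in P. E q k (A M q g) x = (\<Sum>l\<in>?L. E q k (?u l) x)" for k
    unfolding A_def by (intro L2_op_sum[OF E_op] u)
  have "AE x in P. \<forall>l\<in>?L. E q 0 (?u l) x = ?u l x"
    by (intro AE_finite_allI E_D U_L2 g) auto
  with *[of 0] show "AE x in P. E q 0 (A M q g) x = A M q g x"
    by eventually_elim (simp add: A_def)
  have "AE x in P. \<forall>l\<in>?L. E q (-1) (?u l) x = 0"
    by (intro AE_finite_allI E_D U_L2 g) auto
  with *[of "-1"] show "AE x in P. E q (-1) (A M q g) x = 0"
    by eventually_elim simp
qed

text \<open>The hypothesis on \<open>f\<close> in one direction. Operators that commute with the
  conditional expectations of that direction preserve it (\<open>banded_preserved\<close>), which is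
  what the induction over directions rests on.\<close>

definition banded :: "nat \<Rightarrow> nat \<Rightarrow> ('a \<Rightarrow> real) \<Rightarrow> bool" where
  "banded M q g \<longleftrightarrow> (AE x in P. E q (- int M) g x = 0) \<and> (AE x in P. E q (int M) g x = g x)"

lemma U_D:
  assumes "j \<in> Zd d" "g \<in> L2 P P"
  shows "AE x in P. U j (D q l g) x = D q (l + j q) (U j g) x"
  using U_E[OF assms, of q l] U_E[OF assms, of q "l - 1"]
  unfolding D_eq koopman_def by eventually_elim (simp add: algebra_simps)

lemma banded_decomposition:
  assumes q: "q \<in> {1..d}" and g: "g \<in> L2 P P" and bd: "banded M q g"
  shows "AE x in P. g x = A M q g x + (B M q g x - U (unit_vec q) (B M q g) x)"
proof -
  let ?L = "{- int M..<int M}"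
  define w where "w = (\<lambda>l. D q 0 (U (axis_vec q l) g))"
  \<comment> \<open>Shifting by \<open>- l\<close> undoes the shift inside \<open>w l\<close> and
    moves its level from 0 to \<open>- l\<close>.\<close>
  have "AE x in P. \<forall>l\<in>?L. U (axis_vec q (- l)) (w l) x = D q (- l) g x"
  proof (rule AE_finite_allI)
    fix l
    let ?h = "U (axis_vec q l) g"
    have h: "?h \<in> L2 P P" by (rule U_L2[OF g])
    have eq: "AE x in P. U (axis_vec q (- l)) ?h x = g x"
    proof (rule AE_I2)
      fix x assume "x \<in> space P"
      then have "U (axis_vec q (- l)) ?h x = U (\<lambda>r. axis_vec q (- l) r + axis_vec q l r) g x"
        by (rule U_add)
      also have "act (\<lambda>r. axis_vec q (- l) r + axis_vec q l r) = id"
        by (rule act_eq_id) (simp add: axis_vec_def)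
      then have "U (\<lambda>r. axis_vec q (- l) r + axis_vec q l r) g x = g x"
        by (simp add: koopman_def)
      finally show "U (axis_vec q (- l)) ?h x = g x" .
    qed
    have "AE x in P. D q (- l) (U (axis_vec q (- l)) ?h) x = D q (- l) g x"
      by (intro L2_op_cong[OF D_op] U_L2 h g eq)
    with U_D[OF axis_vec_Zd[OF q] h, of "- l" q 0]
    show "AE x in P. U (axis_vec q (- l)) (w l) x = D q (- l) g x"
      unfolding w_def by eventually_elim simp
  next
    show "finite ?L" by simp
  qed
  moreover have "AE x in P. (\<Sum>l\<in>?L. D q (- l) g x) = g x"
  proof -
    have "(\<Sum>l\<in>?L. D q (- l) g x) = E q (int M) g x - E q (- int M) g x" for x
    proof -
      \<comment> \<open>The level \<open>- l\<close> decreases as \<open>l\<close> increases, hence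
        the minus sign before the telescoping sum.\<close>
      have "(\<Sum>l\<in>?L. D q (- l) g x) = - (\<Sum>l\<in>?L. E q (- (l + 1)) g x - E q (- l) g x)"
        by (simp add: D_eq sum_negf[symmetric])
      also have "\<dots> = E q (int M) g x - E q (- int M) g x"
        by (subst sum_telescope_int[where a = "\<lambda>l. E q (- l) g x"]) auto
      finally show ?thesis .
    qed
    then show ?thesis using bd by (auto simp: banded_def)
  qed
  moreover have "AE x in P. A M q g x + (B M q g x - U (unit_vec q) (B M q g) x)
      = (\<Sum>l\<in>?L. U (axis_vec q (- l)) (w l) x)"
  proof (rule AE_I2)
    fix x assume x: "x \<in> space P"
    have "B M q g x - U (unit_vec q) (B M q g) x
        = (\<Sum>l\<in>?L. V q (- l) (w l) x - U (unit_vec q) (V q (- l) (w l)) x)"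
      by (simp add: B_def w_def koopman_def sum_subtractf)
    also have "\<dots> = (\<Sum>l\<in>?L. U (axis_vec q (- l)) (w l) x - w l x)"
      by (simp only: V_coboundary[OF x])
    finally show "A M q g x + (B M q g x - U (unit_vec q) (B M q g) x)
      = (\<Sum>l\<in>?L. U (axis_vec q (- l)) (w l) x)"
      by (simp add: A_def w_def sum_subtractf)
  qed
  ultimately show ?thesis by eventually_elim simp
qed

lemma E_fixed_null_preserved:
  assumes C: "L2_op P C" "L2_commute P C (E q l)" and g: "g \<in> L2 P P"
  shows "AE x in P. E q l g x = 0 \<Longrightarrow> AE x in P. E q l (C g) x = 0"
    and "AE x in P. E q l g x = g x \<Longrightarrow> AE x in P. E q l (C g) x = C g x"
proof -
  have Eg: "E q l g \<in> L2 P P" by (rule L2_op_mem[OF E_op g])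
  show "AE x in P. E q l (C g) x = 0" if "AE x in P. E q l g x = 0"
    using L2_op_zero[OF C(1) Eg that] L2_commuteD[OF C(2) g] by eventually_elim simp
  show "AE x in P. E q l (C g) x = C g x" if "AE x in P. E q l g x = g x"
    using L2_op_cong[OF C(1) Eg g that] L2_commuteD[OF C(2) g] by eventually_elim simp
qed

lemma banded_preserved:
  assumes "L2_op P C" "\<And>l. L2_commute P C (E q l)" "g \<in> L2 P P" "banded M q g"
  shows "banded M q (C g)"
  using assms E_fixed_null_preserved[OF assms(1) assms(2) assms(3)] by (auto simp: banded_def)

section \<open>Products over all directions\<close>

definition AB :: "nat \<Rightarrow> nat set \<Rightarrow> nat \<Rightarrow> ('a \<Rightarrow> real) \<Rightarrow> 'a \<Rightarrow> real" where
  "AB M S q = (if q \<in> S then A M q else B M q)"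

lemma AB_op: "L2_op P (AB M S q)"
  by (simp add: AB_def A_op B_op)

lemma AB_commute_E:
  "q \<in> {1..d} \<Longrightarrow> r \<in> {1..d} \<Longrightarrow> q \<noteq> r \<Longrightarrow> L2_commute P (AB M S q) (E r l)"
  by (simp add: AB_def A_B_commute_E)

definition cob :: "nat \<Rightarrow> ('a \<Rightarrow> real) \<Rightarrow> 'a \<Rightarrow> real" where
  "cob q g = (\<lambda>x. g x - U (unit_vec q) g x)"

lemma cob_op: "L2_op P (cob q)"
  using L2_op_minus[OF L2_op_id U_op, of "unit_vec q"] by (simp add: cob_def[abs_def])

lemma cob_commute: "L2_commute P (cob q) (cob r)"
proof -
  have id: "L2_commute P id C" for C by (simp add: L2_commute_def)
  have *: "L2_commute P (cob q) C" if "L2_op P C" "\<And>i. L2_commute P (U i) C" for q C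
  proof -
    have "L2_commute P (\<lambda>g x. id g x - U (unit_vec q) g x) C"
      by (intro L2_commute_minus L2_op_id U_op that id)
    then show ?thesis by (simp add: cob_def[abs_def])
  qed
  show ?thesis
    by (intro * cob_op L2_commute_sym[OF *] U_op U_U_commute)
qed

text \<open>Direction \<open>n + 1\<close> is split first, into \<open>A g\<close> and the
  coboundary of \<open>B g\<close>. Both functions stay banded in the smaller directions, so the
  induction hypothesis applies to each: the expansion of \<open>A g\<close> gives the subsets
  containing \<open>n + 1\<close>, that of \<open>B g\<close> the others.\<close>

lemma martingale_coboundary_decomposition:
  assumes "n \<le> d" "g \<in> L2 P P" "\<And>q. q \<in> {1..n} \<Longrightarrow> banded M q g"
  shows "AE x in P. g x = (\<Sum>S\<in>Pow {1..n}. comp_over ({1..n} - S) cob (comp_over {1..n} (AB M S) g) x)"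
  using assms
proof (induction n arbitrary: g)
  case 0
  then show ?case by simp
next
  case (Suc n)
  note g = Suc.prems(2)
  let ?q = "Suc n"
  have q: "?q \<in> {1..d}" using Suc.prems(1) by simp
  have Ag: "A M ?q g \<in> L2 P P" and Bg: "B M ?q g \<in> L2 P P"
    by (intro L2_op_mem[OF A_op] L2_op_mem[OF B_op] g)+
  have bd: "banded M r (A M ?q g)" "banded M r (B M ?q g)" if "r \<in> {1..n}" for r
  proof -
    have "?q \<in> {1..d}" "r \<in> {1..d}" "?q \<noteq> r" "r \<in> {1..?q}"
      using that Suc.prems(1) by auto
    note this(4) and com = A_B_commute_E[OF this(1-3)]
    then show "banded M r (A M ?q g)" "banded M r (B M ?q g)"
      using banded_preserved[OF A_op com(1) g Suc.prems(3)] banded_preserved[OF B_op com(2) g Suc.prems(3)]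
      by auto
  qed
  define K where "K = (\<lambda>S. comp_over ({1..n} - S) cob)"
  define C where "C = (\<lambda>S. comp_over {1..n} (AB M S))"
  have K_op: "L2_op P (K S)" for S unfolding K_def by (intro L2_op_comp_over cob_op) auto
  have C_op: "L2_op P (C S)" for S unfolding C_def by (intro L2_op_comp_over AB_op) auto
  have nd: "n \<le> d" using Suc.prems(1) by simp
  have IH_A: "AE x in P. A M ?q g x = (\<Sum>S\<in>Pow {1..n}. K S (C S (A M ?q g)) x)"
    unfolding K_def C_def by (rule Suc.IH[OF nd Ag bd(1)])
  have IH_B: "AE x in P. B M ?q g x = (\<Sum>S\<in>Pow {1..n}. K S (C S (B M ?q g)) x)"
    unfolding K_def C_def by (rule Suc.IH[OF nd Bg bd(2)])
  have KCB: "K S (C S (B M ?q g)) \<in> L2 P P" for S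
    by (intro L2_op_mem[OF K_op] L2_op_mem[OF C_op] Bg)
  have "AE x in P. cob ?q (B M ?q g) x = cob ?q (\<lambda>x. \<Sum>S\<in>Pow {1..n}. K S (C S (B M ?q g)) x) x"
    by (intro L2_op_cong[OF cob_op] Bg L2_sum KCB IH_B)
  moreover have "AE x in P. cob ?q (\<lambda>x. \<Sum>S\<in>Pow {1..n}. K S (C S (B M ?q g)) x) x
      = (\<Sum>S\<in>Pow {1..n}. cob ?q (K S (C S (B M ?q g))) x)"
    by (intro L2_op_sum[OF cob_op] KCB)
  \<comment> \<open>The new \<open>cob\<close> arises outside the product, whereas
    \<open>comp_over\<close> puts the largest index innermost; commutation moves it inside.\<close>
  moreover have "AE x in P. \<forall>S\<in>Pow {1..n}. K S (cob ?q (C S (B M ?q g))) x = cob ?q (K S (C S (B M ?q g))) x"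
  proof (rule AE_finite_allI)
    fix S
    have "L2_commute P (K S) (cob ?q)"
      unfolding K_def by (intro L2_commute_comp_over cob_op cob_commute) auto
    then show "AE x in P. K S (cob ?q (C S (B M ?q g))) x = cob ?q (K S (C S (B M ?q g))) x"
      by (rule L2_commuteD[OF _ L2_op_mem[OF C_op Bg]])
  next
    show "finite (Pow {1..n})" by simp
  qed
  ultimately have cob_B: "AE x in P. cob ?q (B M ?q g) x
      = (\<Sum>S\<in>Pow {1..n}. K S (cob ?q (C S (B M ?q g))) x)"
    by eventually_elim simp
  have split: "(\<Sum>S\<in>Pow {1..?q}. comp_over ({1..?q} - S) cob (comp_over {1..?q} (AB M S) g) x)
      = (\<Sum>S\<in>Pow {1..n}. K S (cob ?q (C S (B M ?q g))) x) + (\<Sum>S\<in>Pow {1..n}. K S (C S (A M ?q g)) x)"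
    (is "sum ?t _ = _") for x
  proof -
    have "{1..?q} = insert ?q {1..n}" by auto
    then have "sum ?t (Pow {1..?q}) = sum ?t (Pow {1..n} \<union> insert ?q ` Pow {1..n})"
      by (simp only: Pow_insert)
    also have "\<dots> = sum ?t (Pow {1..n}) + sum ?t (insert ?q ` Pow {1..n})"
      by (rule sum.union_disjoint) auto
    also have "sum ?t (insert ?q ` Pow {1..n}) = (\<Sum>S\<in>Pow {1..n}. ?t (insert ?q S))"
    proof (rule sum.reindex[unfolded comp_def])
      have "?q \<notin> S" if "S \<in> Pow {1..n}" for S using that by auto
      then show "inj_on (insert ?q) (Pow {1..n})"
        by (intro inj_onI) (metis insert_ident)
    qed
    also have "\<dots> = (\<Sum>S\<in>Pow {1..n}. K S (C S (A M ?q g)) x)"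
    proof (rule sum.cong)
      fix S assume "S \<in> Pow {1..n}"
      then have "{1..?q} - insert ?q S = {1..n} - S" by auto
      moreover have "comp_over {1..n} (AB M (insert ?q S)) = C S"
        unfolding C_def by (rule comp_over_cong) (auto simp: AB_def)
      then have "comp_over {1..?q} (AB M (insert ?q S)) g = C S (A M ?q g)"
        unfolding comp_over_Suc comp_apply by (simp add: AB_def)
      ultimately show "?t (insert ?q S) = K S (C S (A M ?q g)) x"
        by (simp only: K_def)
    qed simp
    also have "sum ?t (Pow {1..n}) = (\<Sum>S\<in>Pow {1..n}. K S (cob ?q (C S (B M ?q g))) x)"
    proof (rule sum.cong)
      fix S assume S: "S \<in> Pow {1..n}"
      then have "?q \<notin> S" by auto
      then have "comp_over {1..?q} (AB M S) g = C S (B M ?q g)"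
        unfolding comp_over_Suc comp_apply C_def by (simp add: AB_def)
      moreover have "{1..?q} - S = insert ?q ({1..n} - S)" using S by auto
      then have "comp_over ({1..?q} - S) cob = K S \<circ> cob ?q"
        by (simp only: K_def) (rule comp_over_insert_max, auto)
      ultimately show "?t S = K S (cob ?q (C S (B M ?q g))) x" by simp
    qed simp
    finally show ?thesis .
  qed
  have "banded M ?q g" by (rule Suc.prems(3)) simp
  from banded_decomposition[OF q g this] IH_A cob_B show ?case
    unfolding split by eventually_elim (simp add: cob_def)
qed

text \<open>Directions above \<open>n\<close> are those already treated, and the assumption on
  \<open>r > n\<close> records the outcome. Factor \<open>n + 1\<close> establishes the property in
  its own direction by \<open>E_A\<close> if that direction is in \<open>S\<close>, and preserves it
  in the larger ones since it commutes with their conditional expectations.\<close>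

lemma AB_adapted:
  assumes "n \<le> d" "g \<in> L2 P P" "S \<subseteq> {1..d}"
    and "\<And>r. r \<in> S \<Longrightarrow> r > n \<Longrightarrow> (AE x in P. E r 0 g x = g x) \<and> (AE x in P. E r (-1) g x = 0)"
    and "r \<in> S"
  shows "(AE x in P. E r 0 (comp_over {1..n} (AB M S) g) x = comp_over {1..n} (AB M S) g x) \<and>
    (AE x in P. E r (-1) (comp_over {1..n} (AB M S) g) x = 0)"
  using assms
proof (induction n arbitrary: g)
  case 0
  \<comment> \<open>At \<open>n = 0\<close> every direction of \<open>S\<close> falls under the
    assumption, because indices are positive.\<close>
  then have "r > 0" by (cases r) auto
  with 0 show ?case by simp
next
  case (Suc n)
  let ?g = "AB M S (Suc n) g"
  note g = Suc.prems(2)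
  have "(AE x in P. E r 0 ?g x = ?g x) \<and> (AE x in P. E r (-1) ?g x = 0)" if r: "r \<in> S" "r > n" for r
  proof (cases "r = Suc n")
    case True
    then show ?thesis using E_A[OF g] r by (simp add: AB_def)
  next
    case False
    then have com: "L2_commute P (AB M S (Suc n)) (E r l)" for l
      using r Suc.prems(1,3) by (intro AB_commute_E) auto
    have "(AE x in P. E r 0 g x = g x) \<and> (AE x in P. E r (-1) g x = 0)"
      using r False by (intro Suc.prems(4)) auto
    then show ?thesis
      using E_fixed_null_preserved[OF AB_op com g] by blast
  qed
  then show ?case
    unfolding comp_over_Suc comp_apply using Suc.prems(1,3,5)
    by (intro Suc.IH L2_op_mem[OF AB_op] g) auto
qed

section \<open>The series for the pure martingale term\<close>

abbreviation cube :: "nat \<Rightarrow> nat \<Rightarrow> (nat \<Rightarrow> int) set" where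
  "cube M n \<equiv> PiE_dflt {1..n} 0 (\<lambda>_. {- int M..<int M})"

text \<open>Multiplying out the product of sums: one \<open>l\<close> per direction is a point of
  the cube. The shifts merge into a single \<open>U j\<close>, because \<open>A M q\<close> commutes
  with every shift that leaves coordinate \<open>q\<close> alone.\<close>

lemma comp_A_expand:
  assumes "n \<le> d" "g \<in> L2 P P"
  shows "AE x in P. comp_over {1..n} (A M) g x
    = (\<Sum>j\<in>cube M n. comp_over {1..n} (\<lambda>q. D q 0) (U j g) x)"
  using assms
proof (induction n arbitrary: g)
  case 0
  have "cube M 0 = {\<lambda>_. 0}" by (auto simp: PiE_dflt_def)
  moreover have "U (\<lambda>_. 0) g = g" by (simp add: koopman_def act_eq_id)
  ultimately show ?case by simp
next
  case (Suc n)
  note g = Suc.prems(2)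
  let ?q = "Suc n" and ?L = "{- int M..<int M}"
  have q: "?q \<in> {1..d}" using Suc.prems(1) by simp
  define C where "C = comp_over {1..n} (\<lambda>q. D q 0)"
  have C_op: "L2_op P C" unfolding C_def by (intro L2_op_comp_over D_op) auto
  define k where "k = (\<lambda>j l r. axis_vec ?q l r + j r)"
  have Ag: "A M ?q g \<in> L2 P P" by (rule L2_op_mem[OF A_op g])
  have reindex: "(\<Sum>j\<in>cube M n. \<Sum>l\<in>?L. C (D ?q 0 (U (k j l) g)) x)
      = (\<Sum>j\<in>cube M ?q. C (D ?q 0 (U j g)) x)" for x
    unfolding k_def by (rule sum_PiE_dflt_Suc[symmetric])
  have "AE x in P. comp_over {1..n} (A M) (A M ?q g) x = (\<Sum>j\<in>cube M n. C (U j (A M ?q g)) x)"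
    unfolding C_def using Suc.prems(1) by (intro Suc.IH Ag) simp
  moreover have "AE x in P. \<forall>j\<in>cube M n. C (U j (A M ?q g)) x = (\<Sum>l\<in>?L. C (D ?q 0 (U (k j l) g)) x)"
  proof (rule AE_finite_allI)
    fix j assume "j \<in> cube M n"
    then have j0: "j r = 0" if "r \<notin> {1..n}" for r
      using that unfolding PiE_dflt_def by blast
    have "j r = 0" if "r \<notin> {1..d}" for r
      using that Suc.prems(1) by (intro j0) auto
    then have "j \<in> Zd d" unfolding Zd_def by blast
    moreover have "j ?q = 0" by (rule j0) simp
    ultimately have j: "j \<in> Zd d" "j ?q = 0" by blast+
    have "L2_commute P (A M ?q) (U j)"
      by (intro A_commute U_op L2_commute_sym[OF U_E_commute[OF j]] U_U_commute)
    then have 1: "AE x in P. U j (A M ?q g) x = A M ?q (U j g) x"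
      by (rule AE_symmetric[OF L2_commuteD[OF _ g]])
    have "AE x in P. \<forall>l\<in>?L. D ?q 0 (U (axis_vec ?q l) (U j g)) x = D ?q 0 (U (k j l) g) x"
      by (intro AE_finite_allI L2_op_cong[OF D_op] U_L2 g AE_I2) (simp_all add: U_add k_def)
    with 1 have 2: "AE x in P. U j (A M ?q g) x = (\<Sum>l\<in>?L. D ?q 0 (U (k j l) g) x)"
      by eventually_elim (simp add: A_def)
    have D_L2: "D ?q 0 (U i g) \<in> L2 P P" for i
      by (intro L2_op_mem[OF D_op] U_L2 g)
    have "AE x in P. C (U j (A M ?q g)) x = C (\<lambda>x. \<Sum>l\<in>?L. D ?q 0 (U (k j l) g) x) x"
      by (intro L2_op_cong[OF C_op] U_L2 Ag L2_sum D_L2 2)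
    moreover have "AE x in P. C (\<lambda>x. \<Sum>l\<in>?L. D ?q 0 (U (k j l) g) x) x
        = (\<Sum>l\<in>?L. C (D ?q 0 (U (k j l) g)) x)"
      by (intro L2_op_sum[OF C_op] D_L2)
    ultimately show "AE x in P. C (U j (A M ?q g)) x = (\<Sum>l\<in>?L. C (D ?q 0 (U (k j l) g)) x)"
      by eventually_elim simp
  next
    show "finite (cube M n)" by (rule finite_PiE_dflt) auto
  qed
  ultimately show ?case
    unfolding comp_over_Suc comp_apply C_def[symmetric] reindex[symmetric] by eventually_elim simp
qed

text \<open>Some coordinate \<open>j q\<close> is out of range, and
  \<open>D q 0 (U j f) = U j (D q (- j q) f)\<close>. Conditional expectations of \<open>f\<close>
  vanish up to level \<open>- M\<close> and equal \<open>f\<close> from level \<open>M\<close> on,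
  so this increment is zero; commutation then annihilates the whole product.\<close>

lemma proj_koopman_zero:
  assumes f: "f \<in> L2 P P" "\<And>q. q \<in> {1..d} \<Longrightarrow> banded M q f" and j: "j \<in> Zd d - cube M d"
  shows "AE x in P. comp_over {1..d} (\<lambda>q. D q 0) (U j f) x = 0"
proof -
  from j obtain q where q: "q \<in> {1..d}" "j q \<notin> {- int M..<int M}" and j: "j \<in> Zd d"
    unfolding PiE_dflt_def Zd_def by blast
  have bd: "AE x in P. E q (- int M) f x = 0" "AE x in P. E q (int M) f x = f x"
    using f(2)[OF q(1)] by (auto simp: banded_def)
  have low: "AE x in P. E q l f x = 0" if "l \<le> - int M" for l
    using L2_op_zero[OF E_op L2_op_mem[OF E_op f(1)] bd(1), of q l] E_E_tower(1)[OF f(1) that, of q]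
    by eventually_elim simp
  have high: "AE x in P. E q l f x = f x" if "l \<ge> int M" for l
    using L2_op_cong[OF E_op L2_op_mem[OF E_op f(1)] f(1) bd(2), of q l] E_E_tower(2)[OF f(1) that, of q] bd(2)
    by eventually_elim simp
  have "AE x in P. D q (- j q) f x = 0"
  \<comment> \<open>If \<open>j q \<ge> M\<close>, both \<open>- j q\<close> and its predecessor are
    at most \<open>- M\<close>. If \<open>j q < - M\<close>, already the lower level
    \<open>- j q - 1\<close> is at least \<open>M\<close>.\<close>
  proof (cases "j q \<ge> int M")
    case True
    then have "AE x in P. E q (- j q) f x = 0" "AE x in P. E q (- j q - 1) f x = 0"
      by (intro low; simp)+
    then show ?thesis
      unfolding D_eq by eventually_elim simp
  next
    case False
    then have "- j q - 1 \<ge> int M" using q(2) by auto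
    then have "AE x in P. E q (- j q) f x = f x" "AE x in P. E q (- j q - 1) f x = f x"
      by (intro high; simp)+
    then show ?thesis
      unfolding D_eq by eventually_elim simp
  qed
  from L2_op_zero[OF U_op L2_op_mem[OF D_op f(1)] this, of j] U_D[OF j f(1), of q "- j q"]
  have "AE x in P. D q 0 (U j f) x = 0" by eventually_elim simp
  moreover have "L2_commute P (D r 0) (D s 0)" if "r \<in> {1..d}" "s \<in> {1..d}" "r \<noteq> s" for r s
    by (rule D_commute[OF D_op L2_commute_sym[OF D_commute[OF E_op E_E_commute]]])
      (use that in auto)
  ultimately show ?thesis
    using q(1) by (intro comp_over_AE_zero[where q = q] D_op U_L2 f(1))
qed

text \<open>An element of \<open>L2 P (DF q (-1))\<close> need only have a representative
  \<open>g'\<close> measurable at level -1; it is against \<open>g'\<close> that \<open>h\<close>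
  may be replaced by \<open>E q (-1) h\<close>, which is zero.\<close>

lemma adapted_L2_ominus:
  assumes h: "h \<in> L2 P P" "AE x in P. E q 0 h x = h x" "AE x in P. E q (-1) h x = 0"
  shows "h \<in> L2_ominus P (L2 P (DF q 0)) (L2 P (DF q (-1)))"
  unfolding L2_ominus_def
proof (intro CollectI conjI ballI)
  have "\<exists>g\<in>borel_measurable (DF q 0). AE x in P. h x = g x"
    using h(2) by (intro bexI[of _ "E q 0 h"]) auto
  then show "h \<in> L2 P (DF q 0)" using h(1) by (simp add: L2_def)
next
  fix g assume "g \<in> L2 P (DF q (-1))"
  then obtain g' where g: "g \<in> L2 P P" and g': "g' \<in> borel_measurable (DF q (-1))" and eq: "AE x in P. g x = g' x"
    by (auto simp: L2_def)
  have g'_P: "g' \<in> borel_measurable P" by (rule measurable_from_subalg[OF subalgebra_dir g'])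
  have g'_L2: "g' \<in> L2 P P" by (rule L2_cong_AE[OF g g'_P eq])
  have "(LINT x|P. h x * g x) = (LINT x|P. g' x * h x)"
    unfolding mult.commute[of "h _"]
    using eq L2_self_measurable[OF g] L2_self_measurable[OF h(1)] g'_P by (intro integral_mult_cong_AE)
  also have "\<dots> = (LINT x|P. g' x * E q (-1) h x)"
    by (rule dir.real_cond_exp_intg(2)[symmetric, OF L2_mult_integrable[OF g'_L2 h(1)] g' L2_self_measurable[OF h(1)]])
  also have "\<dots> = (LINT x|P. 0)"
  proof (rule integral_cong_AE)
    show "AE x in P. g' x * E q (-1) h x = 0" using h(3) by eventually_elim simp
  qed (use g'_P in auto)
  finally show "(LINT x|P. h x * g x) = 0" by simp
qed

text \<open>Terms outside the cube vanish, so every finite partial sum containing the cube equals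
  the limit almost everywhere, and the error is eventually exactly 0.\<close>

lemma L2_has_sum_proj:
  assumes f: "f \<in> L2 P P" "\<And>q. q \<in> {1..d} \<Longrightarrow> banded M q f"
  shows "L2_has_sum P (\<lambda>j. proj P d T \<M> (\<lambda>_. 0) (U j f)) (Zd d) (comp_over {1..d} (A M) f)"
    (is "L2_has_sum P ?g _ ?s")
proof -
  have g_eq: "?g j = comp_over {1..d} (\<lambda>q. D q 0) (U j f)" for j by (simp add: proj_def)
  have g: "?g j \<in> L2 P P" for j
    unfolding g_eq by (rule L2_op_mem[OF L2_op_comp_over U_L2[OF f(1)]]) (auto intro: D_op)
  have s: "?s \<in> L2 P P"
    by (rule L2_op_mem[OF L2_op_comp_over f(1)]) (auto intro: A_op)
  have box: "finite (cube M d)" "cube M d \<subseteq> Zd d"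
  proof -
    show "finite (cube M d)" by (rule finite_PiE_dflt) simp_all
    show "cube M d \<subseteq> Zd d" unfolding PiE_dflt_def Zd_def by blast
  qed
  have zero: "sqrt (LINT x|P. (?s x - (\<Sum>j\<in>X. ?g j x))\<^sup>2) = 0"
    if X: "finite X" "cube M d \<subseteq> X" "X \<subseteq> Zd d" for X
  proof -
    have "AE x in P. \<forall>j\<in>X - cube M d. ?g j x = 0"
      unfolding g_eq using X by (intro AE_finite_allI proj_koopman_zero[OF f]) auto
    moreover have "AE x in P. ?s x = (\<Sum>j\<in>cube M d. ?g j x)"
      unfolding g_eq by (rule comp_A_expand[OF order.refl f(1)])
    ultimately have "AE x in P. (?s x - (\<Sum>j\<in>X. ?g j x))\<^sup>2 = 0"
    proof eventually_elim
      case (elim x)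
      have "(\<Sum>j\<in>X. ?g j x) = (\<Sum>j\<in>cube M d. ?g j x)"
        using X elim(1) by (intro sum.mono_neutral_right) auto
      with elim(2) show ?case by simp
    qed
    then have "(LINT x|P. (?s x - (\<Sum>j\<in>X. ?g j x))\<^sup>2) = 0"
      by (rule integral_eq_zero_AE)
    then show ?thesis by simp
  qed
  have "eventually (\<lambda>X. sqrt (LINT x|P. (?s x - (\<Sum>j\<in>X. ?g j x))\<^sup>2) = 0) (finite_subsets_at_top (Zd d))"
    unfolding eventually_finite_subsets_at_top using box zero by (intro exI[of _ "cube M d"]) blast
  then show ?thesis
    unfolding L2_has_sum_def using g s by (auto intro: tendsto_eventually)
qed

end

theorem proposition4p1:
  fixes P :: "'a measure" and d :: nat and T :: "nat \<Rightarrow> 'a \<Rightarrow> 'a" and \<M> :: "'a measure"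
    and f :: "'a \<Rightarrow> real" and M :: nat
  assumes "d \<ge> 1"
    and "completely_commuting P d T \<M>"
    and "f \<in> L2 P P"
    and "\<And>q. q \<in> {1..d} \<Longrightarrow>
           AE x in P. real_cond_exp P (dir_filt P d T \<M> q (- int M)) f x = 0"
    and "\<And>q. q \<in> {1..d} \<Longrightarrow>
           AE x in P. f x - real_cond_exp P (dir_filt P d T \<M> q (int M)) f x = 0"
  shows "\<exists>h :: nat set \<Rightarrow> 'a \<Rightarrow> real.
    (AE x in P. f x =
       (\<Sum>S\<in>Pow {1..d}.
          comp_over ({1..d} - S) (\<lambda>q g y. g y - koopman P d T (unit_vec q) g y) (h S) x)) \<and>
    (\<forall>S\<in>Pow {1..d}. h S \<in> L2 P P \<inter>
       (\<Inter>q\<in>S. L2_ominus P (L2 P (dir_filt P d T \<M> q 0)) (L2 P (dir_filt P d T \<M> q (-1))))) \<and>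
    L2_has_sum P (\<lambda>j. proj P d T \<M> (\<lambda>_. 0) (koopman P d T j f)) (Zd d) (h {1..d})"
proof -
  interpret completely_commuting P d T \<M> by fact
  note f = \<open>f \<in> L2 P P\<close>
  have bd: "banded M q f" if "q \<in> {1..d}" for q
    using assms(4,5)[OF that] by (auto simp: banded_def)
  define h where "h = (\<lambda>S. comp_over {1..d} (AB M S) f)"
  have h_L2: "h S \<in> L2 P P" for S
    unfolding h_def by (rule L2_op_mem[OF L2_op_comp_over f]) (auto intro: AB_op)
  have cob: "(\<lambda>q g y. g y - koopman P d T (unit_vec q) g y) = cob"
    by (simp add: cob_def fun_eq_iff)
  have "AE x in P. f x = (\<Sum>S\<in>Pow {1..d}. comp_over ({1..d} - S) cob (h S) x)"
    unfolding h_def by (rule martingale_coboundary_decomposition[OF order.refl f bd])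
  moreover have "h S \<in> L2_ominus P (L2 P (DF q 0)) (L2 P (DF q (-1)))" if "S \<subseteq> {1..d}" "q \<in> S" for S q
  proof -
    \<comment> \<open>With \<open>n = d\<close> the assumption of \<open>AB_adapted\<close> on
      directions above \<open>n\<close> is vacuous.\<close>
    have "\<not> r > d" if "r \<in> S" for r using \<open>S \<subseteq> {1..d}\<close> that by auto
    then show ?thesis
      using AB_adapted[OF order.refl f that(1) _ that(2), of M] h_L2
      unfolding h_def by (intro adapted_L2_ominus) blast+
  qed
  moreover have "h {1..d} = comp_over {1..d} (A M) f"
    unfolding h_def by (rule fun_cong[OF comp_over_cong]) (auto simp: AB_def)
  then have "L2_has_sum P (\<lambda>j. proj P d T \<M> (\<lambda>_. 0) (U j f)) (Zd d) (h {1..d})"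
    using L2_has_sum_proj[OF f bd] by simp
  ultimately show ?thesis
    unfolding cob using h_L2 by (intro exI[of _ h]) auto
qed

end
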